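(* (Generalized Cartan's formulas) Let $\mathbb{K}$ be a field with $\mathrm{char}(\mathbb{K})\neq 2$, let $(L,[-,-],\alpha_L)$ be a multiplicative Hom-Lie algebra over $\mathbb{K}$ and $(M,\alpha_M)$ a right Hom-$L$-module. With $d_n$, $\theta_n(y)$ and $i_n(\alpha_L(y))$ the linear maps on $C_n^{\alpha}(L,M)=M\otimes\Lambda^nL$ defined in the context, the following identities hold for all $x,y\in L$: (a) $d_{n+1}\, i_{n}(\alpha_{L}(y)) + i_{n-1}(\alpha_{L}^{2}(y))\, d_{n} = -\theta_{n}(y)$, for all $n\geq 1$. (b) $\theta_{n}(\alpha_{L}(x))\,\theta_{n}(y) - \theta_{n}(\alpha_{L}(y))\,\theta_{n}(x) = \theta_{n}([x,y])\,(\alpha_{M}\otimes\alpha_{L}^{\wedge n})$, for all $n\geq 0$. (c) $\theta_{n}(x)\, i_{n-1}(\alpha_{L}(y)) - i_{n-1}(\alpha_{L}^{2}(y))\,\theta_{n-1}(x) = i_{n-1}(\alpha_{L}[x,y])\,(\alpha_{M}\otimes\alpha_{L}^{\wedge(n-1)})$, for all $n\geq 1$. (d) $\theta_{n-1}(\alpha_{L}(y))\, d_{n} = d_{n}\,\theta_{n}(y)$, for all $n\geq 1$. (e) $d_{n}\, d_{n+1}=0$, for all $n\geq 1$.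
   Context: A multiplicative Hom-Lie algebra $(L,[-,-],\alpha_L)$ is a $\mathbb{K}$-vector space $L$ with a bilinear bracket and a linear map $\alpha_L:L\to L$ such that $[x,y]=-[y,x]$, $[\alpha_L(x),[y,z]]+[\alpha_L(z),[x,y]]+[\alpha_L(y),[z,x]]=0$ and $\alpha_L([x,y])=[\alpha_L(x),\alpha_L(y)]$ for all $x,y,z\in L$. A right Hom-$L$-module $(M,\alpha_M)$ is a $\mathbb{K}$-vector space $M$ with a linear map $\alpha_M:M\to M$ and a bilinear map $M\times L\to M$, $(m,x)\mapsto m\cdot x$, such that $\alpha_M(m)\cdot[x,y]=(m\cdot x)\cdot\alpha_L(y)-(m\cdot y)\cdot\alpha_L(x)$ and $\alpha_M(m\cdot x)=\alpha_M(m)\cdot\alpha_L(x)$ for all $x,y\in L$, $m\in M$. For $n\ge0$ put $C_n^{\alpha}(L,M)=M\otimes\Lambda^nL$. For $n\ge1$, $d_n:C_n^{\alpha}(L,M)\to C_{n-1}^{\alpha}(L,M)$ is the linear map $$d_n(m\otimes x_1\wedge\cdots\wedge x_n)=\sum_{i=1}^n(-1)^{i+1}m\cdot x_i\otimes\alpha_L(x_1)\wedge\cdots\wedge\widehat{\alpha_L(x_i)}\wedge\cdots\wedge\alpha_L(x_n)$$ $$+\sum_{1\le i<j\le n}(-1)^{i+j}\alpha_M(m)\otimes[x_i,x_j]\wedge\alpha_L(x_1)\wedge\cdots\wedge\widehat{\alpha_L(x_i)}\wedge\cdots\wedge\widehat{\alpha_L(x_j)}\wedge\cdots\wedge\alpha_L(x_n).$$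 For $y\in L$ and $n\ge0$, $\theta_n(y):C_n^{\alpha}(L,M)\to C_n^{\alpha}(L,M)$ is the linear map $$\theta_n(y)(m\otimes x_1\wedge\cdots\wedge x_n)=-m\cdot y\otimes\alpha_L(x_1)\wedge\cdots\wedge\alpha_L(x_n)+\sum_{i=1}^n(-1)^i\alpha_M(m)\otimes[x_i,y]\wedge\alpha_L(x_1)\wedge\cdots\wedge\widehat{\alpha_L(x_i)}\wedge\cdots\wedge\alpha_L(x_n)$$ (so $\theta_0(y)(m)=-m\cdot y$), and $i_n(\alpha_L(y)):C_n^{\alpha}(L,M)\to C_{n+1}^{\alpha}(L,M)$ is the linear map $$i_n(\alpha_L(y))(m\otimes x_1\wedge\cdots\wedge x_n)=(-1)^n\,m\otimes x_1\wedge\cdots\wedge x_n\wedge y.$$ The symbol $i_n(\alpha_L(y))$ is notation for this operator, which is determined by $y$. Thus $i_n(\alpha_L^2(y))$ is the operator determined by $\alpha_L(y)$ (it wedges with $\alpha_L(y)$), and $i_n(\alpha_L[x,y])$ is the operator determined by $[x,y]$ (it wedges with $[x,y]$). Finally $\alpha_M\otimes\alpha_L^{\wedge n}$ sends $m\otimes x_1\wedge\cdots\wedge x_n$ to $\alpha_M(m)\otimes\alpha_L(x_1)\wedge\cdots\wedge\alpha_L(x_n)$. *)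

theory Defs
  imports Complex_Main "HOL-Library.Poly_Mapping" "HOL-Algebra.Module"
begin

text \<open>
  Vector spaces that are given in advance (\<open>L\<close>, \<open>M\<close>) are types with a scalar multiplication
  satisfying the locale \<open>vector_space\<close>. Spaces that are constructed (\<open>\<Lambda>\<^sup>n L\<close>, \<open>M \<otimes> \<Lambda>\<^sup>n L\<close>) depend
  on the scalar multiplications and on \<open>n\<close>; they are values of the record type \<open>module\<close>,
  with scalars in the type \<open>'k\<close>. The record fields \<open>mult\<close> and \<open>one\<close> have no meaning
  for them.
\<close>

section \<open>Hom-Lie algebras and modules\<close>

locale hom_lie_algebra = L: vector_space scaleL
  for scaleL :: "'k::field \<Rightarrow> 'l::ab_group_add \<Rightarrow> 'l" +
  fixes br :: "'l \<Rightarrow> 'l \<Rightarrow> 'l" and \<alpha>L :: "'l \<Rightarrow> 'l"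
  assumes br_linear_right: "Vector_Spaces.linear scaleL scaleL (\<lambda>y. br x y)"
    and br_linear_left: "Vector_Spaces.linear scaleL scaleL (\<lambda>x. br x y)"
    and \<alpha>L_linear: "Vector_Spaces.linear scaleL scaleL \<alpha>L"
    and br_skew: "br x y = - br y x"
    and hom_jacobi: "br (\<alpha>L x) (br y z) + br (\<alpha>L z) (br x y) + br (\<alpha>L y) (br z x) = 0"
    and \<alpha>L_br: "\<alpha>L (br x y) = br (\<alpha>L x) (\<alpha>L y)"

locale right_hom_module = hom_lie_algebra scaleL br \<alpha>L + M: vector_space scaleM
  for scaleL :: "'k::field \<Rightarrow> 'l::ab_group_add \<Rightarrow> 'l" and br and \<alpha>L
    and scaleM :: "'k \<Rightarrow> 'm::ab_group_add \<Rightarrow> 'm" +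
  fixes act :: "'m \<Rightarrow> 'l \<Rightarrow> 'm" and \<alpha>M :: "'m \<Rightarrow> 'm"
  assumes act_linear_right: "Vector_Spaces.linear scaleL scaleM (\<lambda>x. act m x)"
    and act_linear_left: "Vector_Spaces.linear scaleM scaleM (\<lambda>m. act m x)"
    and \<alpha>M_linear: "Vector_Spaces.linear scaleM scaleM \<alpha>M"
    and act_br: "act (\<alpha>M m) (br x y) = act (act m x) (\<alpha>L y) - act (act m y) (\<alpha>L x)"
    and \<alpha>M_act: "\<alpha>M (act m x) = act (\<alpha>M m) (\<alpha>L x)"

section \<open>Free spaces, quotients, linear maps\<close>

abbreviation gen :: "'a \<Rightarrow> ('a \<Rightarrow>\<^sub>0 'k::field)"
  where "gen a \<equiv> Poly_Mapping.single a 1"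

definition fscale :: "'k::field \<Rightarrow> ('a \<Rightarrow>\<^sub>0 'k) \<Rightarrow> ('a \<Rightarrow>\<^sub>0 'k)"
  where "fscale c p = Poly_Mapping.map ((*) c) p"

lemma lookup_fscale: "Poly_Mapping.lookup (fscale c p) a = c * Poly_Mapping.lookup p a"
  unfolding fscale_def by transfer (simp add: when_def)

interpretation free: vector_space fscale
  by unfold_locales
    (rule poly_mapping_eqI, simp add: lookup_fscale lookup_add algebra_simps)+

definition free_on :: "'a set \<Rightarrow> ('a \<Rightarrow>\<^sub>0 'k::field) set"
  where "free_on A = {p. Poly_Mapping.keys p \<subseteq> A}"

definition coset :: "'v::ab_group_add set \<Rightarrow> 'v \<Rightarrow> 'v set"
  where "coset W v = {v + w | w. w \<in> W}"

text \<open>The quotient of a subspace \<open>U\<close> by a subspace \<open>W \<subseteq> U\<close>; the unions are over sets that do not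
  depend on the representatives.\<close>

definition quot_space :: "('k \<Rightarrow> 'v \<Rightarrow> 'v) \<Rightarrow> 'v::ab_group_add set \<Rightarrow> 'v set \<Rightarrow> ('k, 'v set) module"
  where "quot_space scl U W =
    \<lparr>carrier = coset W ` U, mult = undefined, one = undefined,
     zero = coset W 0,
     add = (\<lambda>X Y. \<Union>x\<in>X. \<Union>y\<in>Y. coset W (x + y)),
     smult = (\<lambda>c X. \<Union>x\<in>X. coset W (scl c x))\<rparr>"

definition lin_maps :: "('k, 'v) module \<Rightarrow> ('k, 'w) module \<Rightarrow> ('v \<Rightarrow> 'w) set"
  where "lin_maps V W = {F \<in> carrier V \<rightarrow>\<^sub>E carrier W.
    (\<forall>u\<in>carrier V. \<forall>v\<in>carrier V. F (u \<oplus>\<^bsub>V\<^esub> v) = F u \<oplus>\<^bsub>W\<^esub> F v) \<and>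
    (\<forall>c. \<forall>v\<in>carrier V. F (c \<odot>\<^bsub>V\<^esub> v) = c \<odot>\<^bsub>W\<^esub> F v)}"

section \<open>Exterior powers and tensor products\<close>

definition ext_rels :: "('k::field \<Rightarrow> 'l::ab_group_add \<Rightarrow> 'l) \<Rightarrow> nat \<Rightarrow> ('l list \<Rightarrow>\<^sub>0 'k) set"
  where "ext_rels scaleL n =
    {gen (us @ (x + y) # vs) - gen (us @ x # vs) - gen (us @ y # vs) | us x y vs.
       length us + length vs + 1 = n} \<union>
    {gen (us @ scaleL c x # vs) - fscale c (gen (us @ x # vs)) | us c x vs.
       length us + length vs + 1 = n} \<union>
    {gen xs | xs. length xs = n \<and> \<not> distinct xs}"

definition ext_power :: "('k::field \<Rightarrow> 'l::ab_group_add \<Rightarrow> 'l) \<Rightarrow> nat \<Rightarrow> ('k, ('l list \<Rightarrow>\<^sub>0 'k) set) module"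
  where "ext_power scaleL n =
    quot_space fscale (free_on {xs. length xs = n}) (free.span (ext_rels scaleL n))"

definition wedge :: "('k::field \<Rightarrow> 'l::ab_group_add \<Rightarrow> 'l) \<Rightarrow> 'l list \<Rightarrow> ('l list \<Rightarrow>\<^sub>0 'k) set"
  where "wedge scaleL xs = coset (free.span (ext_rels scaleL (length xs))) (gen xs)"

definition tensor_rels ::
    "('k::field \<Rightarrow> 'm::ab_group_add \<Rightarrow> 'm) \<Rightarrow> ('k, 'v) module \<Rightarrow> ('m \<times> 'v \<Rightarrow>\<^sub>0 'k) set"
  where "tensor_rels scaleM V =
    {gen (m + m', v) - gen (m, v) - gen (m', v) | m m' v. v \<in> carrier V} \<union>
    {gen (scaleM c m, v) - fscale c (gen (m, v)) | c m v. v \<in> carrier V} \<union>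
    {gen (m, v \<oplus>\<^bsub>V\<^esub> v') - gen (m, v) - gen (m, v') | m v v'. v \<in> carrier V \<and> v' \<in> carrier V} \<union>
    {gen (m, c \<odot>\<^bsub>V\<^esub> v) - fscale c (gen (m, v)) | c m v. v \<in> carrier V}"

definition tensor ::
    "('k::field \<Rightarrow> 'm::ab_group_add \<Rightarrow> 'm) \<Rightarrow> ('k, 'v) module \<Rightarrow> ('k, ('m \<times> 'v \<Rightarrow>\<^sub>0 'k) set) module"
  where "tensor scaleM V =
    quot_space fscale (free_on (UNIV \<times> carrier V)) (free.span (tensor_rels scaleM V))"

definition tens ::
    "('k::field \<Rightarrow> 'm::ab_group_add \<Rightarrow> 'm) \<Rightarrow> ('k, 'v) module \<Rightarrow> 'm \<Rightarrow> 'v \<Rightarrow> ('m \<times> 'v \<Rightarrow>\<^sub>0 'k) set"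
  where "tens scaleM V m v = coset (free.span (tensor_rels scaleM V)) (gen (m, v))"

section \<open>The chain spaces and their operators\<close>

type_synonym ('k, 'l, 'm) chain = "('m \<times> ('l list \<Rightarrow>\<^sub>0 'k) set \<Rightarrow>\<^sub>0 'k) set"

definition chain_space ::
    "('k::field \<Rightarrow> 'l::ab_group_add \<Rightarrow> 'l) \<Rightarrow> ('k \<Rightarrow> 'm::ab_group_add \<Rightarrow> 'm) \<Rightarrow> nat
      \<Rightarrow> ('k, ('k, 'l, 'm) chain) module"
  where "chain_space scaleL scaleM n = tensor scaleM (ext_power scaleL n)"

text \<open>\<open>m \<otimes> x\<^sub>1 \<and> \<dots> \<and> x\<^sub>n\<close> for \<open>xs = [x\<^sub>1, \<dots>, x\<^sub>n]\<close>:\<close>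

definition elem ::
    "('k::field \<Rightarrow> 'l::ab_group_add \<Rightarrow> 'l) \<Rightarrow> ('k \<Rightarrow> 'm::ab_group_add \<Rightarrow> 'm) \<Rightarrow> 'm \<Rightarrow> 'l list
      \<Rightarrow> ('k, 'l, 'm) chain"
  where "elem scaleL scaleM m xs =
    tens scaleM (ext_power scaleL (length xs)) m (wedge scaleL xs)"

text \<open>The linear map on \<open>M \<otimes> \<Lambda>\<^sup>n L\<close> with prescribed values on the elements \<open>m \<otimes> x\<^sub>1 \<and> \<dots> \<and> x\<^sub>n\<close>. These
  elements span, so there is at most one; it exists iff the values are multilinear and are
  alternating in the \<open>x\<^sub>i\<close>. The values used below are so for a module over a Hom-Lie algebra;
  for the differential this uses \<open>[x, x] = 0\<close>, hence characteristic \<open>\<noteq> 2\<close>.\<close>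

definition lin_ext ::
    "('k::field \<Rightarrow> 'l::ab_group_add \<Rightarrow> 'l) \<Rightarrow> ('k \<Rightarrow> 'm::ab_group_add \<Rightarrow> 'm) \<Rightarrow> nat
      \<Rightarrow> ('k, 'w) module \<Rightarrow> ('m \<Rightarrow> 'l list \<Rightarrow> 'w) \<Rightarrow> ('k, 'l, 'm) chain \<Rightarrow> 'w"
  where "lin_ext scaleL scaleM n W g =
    (THE F. F \<in> lin_maps (chain_space scaleL scaleM n) W \<and>
      (\<forall>m xs. length xs = n \<longrightarrow> F (elem scaleL scaleM m xs) = g m xs))"

text \<open>Lists are indexed from \<open>0\<close>: \<open>xs ! i\<close> is \<open>x\<^sub>i\<^sub>+\<^sub>1\<close>. Hence \<open>(-1)\<^sup>i\<^sup>+\<^sup>1\<close> in the sum over \<open>1 \<le> i \<le> n\<close>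
  becomes \<open>(-1) ^ i\<close> and \<open>(-1)\<^sup>i\<close> becomes \<open>(-1) ^ (i + 1)\<close>, while \<open>(-1)\<^sup>i\<^sup>+\<^sup>j\<close> is unchanged.
  Omission of factors is \<open>nths\<close> with a complement. The differential is meant for \<open>n \<ge> 1\<close> only.\<close>

definition diff ::
    "('k::field \<Rightarrow> 'l::ab_group_add \<Rightarrow> 'l) \<Rightarrow> ('l \<Rightarrow> 'l \<Rightarrow> 'l) \<Rightarrow> ('l \<Rightarrow> 'l)
      \<Rightarrow> ('k \<Rightarrow> 'm::ab_group_add \<Rightarrow> 'm) \<Rightarrow> ('m \<Rightarrow> 'l \<Rightarrow> 'm) \<Rightarrow> ('m \<Rightarrow> 'm)
      \<Rightarrow> nat \<Rightarrow> ('k, 'l, 'm) chain \<Rightarrow> ('k, 'l, 'm) chain"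
  where "diff scaleL br \<alpha>L scaleM act \<alpha>M n =
    (let C = chain_space scaleL scaleM (n - 1); e = elem scaleL scaleM in
     lin_ext scaleL scaleM n C (\<lambda>m xs.
       (\<Oplus>\<^bsub>C\<^esub>i\<in>{..<n}. (-1) ^ i \<odot>\<^bsub>C\<^esub> e (act m (xs ! i)) (nths (map \<alpha>L xs) (- {i})))
       \<oplus>\<^bsub>C\<^esub>
       (\<Oplus>\<^bsub>C\<^esub>j\<in>{..<n}. \<Oplus>\<^bsub>C\<^esub>i\<in>{..<j}.
          (-1) ^ (i + j) \<odot>\<^bsub>C\<^esub>
            e (\<alpha>M m) (br (xs ! i) (xs ! j) # nths (map \<alpha>L xs) (- {i, j})))))"

definition theta ::
    "('k::field \<Rightarrow> 'l::ab_group_add \<Rightarrow> 'l) \<Rightarrow> ('l \<Rightarrow> 'l \<Rightarrow> 'l) \<Rightarrow> ('l \<Rightarrow> 'l)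
      \<Rightarrow> ('k \<Rightarrow> 'm::ab_group_add \<Rightarrow> 'm) \<Rightarrow> ('m \<Rightarrow> 'l \<Rightarrow> 'm) \<Rightarrow> ('m \<Rightarrow> 'm)
      \<Rightarrow> nat \<Rightarrow> 'l \<Rightarrow> ('k, 'l, 'm) chain \<Rightarrow> ('k, 'l, 'm) chain"
  where "theta scaleL br \<alpha>L scaleM act \<alpha>M n y =
    (let C = chain_space scaleL scaleM n; e = elem scaleL scaleM in
     lin_ext scaleL scaleM n C (\<lambda>m xs.
       (\<ominus>\<^bsub>C\<^esub> e (act m y) (map \<alpha>L xs))
       \<oplus>\<^bsub>C\<^esub>
       (\<Oplus>\<^bsub>C\<^esub>i\<in>{..<n}.
          (-1) ^ (i + 1) \<odot>\<^bsub>C\<^esub> e (\<alpha>M m) (br (xs ! i) y # nths (map \<alpha>L xs) (- {i})))))"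

text \<open>\<open>insertion \<dots> n y\<close> is the operator written \<open>i\<^sub>n(\<alpha>\<^sub>L(y))\<close> in the literature: it is determined
  by \<open>y\<close> and wedges with \<open>y\<close> itself, not with \<open>\<alpha>\<^sub>L(y)\<close>.\<close>

definition insertion ::
    "('k::field \<Rightarrow> 'l::ab_group_add \<Rightarrow> 'l) \<Rightarrow> ('k \<Rightarrow> 'm::ab_group_add \<Rightarrow> 'm)
      \<Rightarrow> nat \<Rightarrow> 'l \<Rightarrow> ('k, 'l, 'm) chain \<Rightarrow> ('k, 'l, 'm) chain"
  where "insertion scaleL scaleM n y =
    (let C = chain_space scaleL scaleM (n + 1) in
     lin_ext scaleL scaleM n C (\<lambda>m xs. (-1) ^ n \<odot>\<^bsub>C\<^esub> elem scaleL scaleM m (xs @ [y])))"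

definition twist ::
    "('k::field \<Rightarrow> 'l::ab_group_add \<Rightarrow> 'l) \<Rightarrow> ('l \<Rightarrow> 'l)
      \<Rightarrow> ('k \<Rightarrow> 'm::ab_group_add \<Rightarrow> 'm) \<Rightarrow> ('m \<Rightarrow> 'm)
      \<Rightarrow> nat \<Rightarrow> ('k, 'l, 'm) chain \<Rightarrow> ('k, 'l, 'm) chain"
  where "twist scaleL \<alpha>L scaleM \<alpha>M n =
    lin_ext scaleL scaleM n (chain_space scaleL scaleM n)
      (\<lambda>m xs. elem scaleL scaleM (\<alpha>M m) (map \<alpha>L xs))"

end

theory Submission
  imports Defs
begin

text \<open>
  The idea. Up to the sign \<open>(-1)\<^sup>n\<close>, wedging with \<open>y\<close> on the right of \<open>x\<^sub>1 \<and> \<dots> \<and> x\<^sub>n\<close> is wedging with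
  \<open>y\<close> on the left; so the insertion operator is \<open>m \<otimes> w \<mapsto> m \<otimes> y \<and> w\<close> without any sign
  (\<open>pure_rotate\<close>). Splitting off the first factor in the defining sums of \<open>\<theta>\<close> and \<open>d\<close> gives the
  recursions (\<open>lie_fun_Cons\<close>, \<open>bd_fun_Cons\<close>)

    \<open>\<theta>(x) \<iota>(y) = \<iota>(\<alpha> y) \<theta>(x) + \<iota>([x, y]) A\<close>  and  \<open>d \<iota>(y) = - \<iota>(\<alpha> y) d - \<theta>(y)\<close>,

  where \<open>A\<close> is the twist; these are two of the formulas. Since every tensor
  \<open>m \<otimes> x\<^sub>1 \<and> \<dots> \<and> x\<^sub>n\<close> arises from \<open>m\<close> by insertions, the others follow by induction on \<open>n\<close>, moving
  an insertion to the left with the recursions (\<open>flinear_eqI_ins\<close>): first \<open>\<theta>(\<alpha> y) A = A \<theta>(y)\<close> and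
  \<open>d A = A d\<close>; then \<open>\<theta>(\<alpha> x) \<theta>(y) - \<theta>(\<alpha> y) \<theta>(x) = \<theta>([x, y]) A\<close>, from the Hom-Jacobi identity and,
  in degree \<open>0\<close>, the module law; then \<open>\<theta>(\<alpha> y) d = d \<theta>(y)\<close>, which uses the previous one; and finally
  \<open>d d = 0\<close>, which uses the equation before it.

  The same recursions show that the values prescribed for \<open>\<theta>\<close> and \<open>d\<close> are multilinear and
  alternating, so that these operators exist at all; for \<open>d\<close> this needs \<open>[x, x] = 0\<close>.

  For the calculations, all the chain spaces are realized inside one vector space, the free space
  \<open>F\<close> on pairs \<open>(m, [x\<^sub>1, \<dots>, x\<^sub>n])\<close>: the quotient of \<open>F\<close> by the relations of the tensor products
  is identified with a complement of the span of the relations, the image of a linear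
  projection. The operators become linear maps \<open>F \<rightarrow> F\<close> and the formulas become equations between
  them. An injective homomorphism \<open>emb\<close> from each chain space to \<open>F\<close> carries elementary tensors to
  elementary tensors (\<open>emb_elem\<close>, \<open>emb_inj\<close>), and it intertwines an operator given by its values
  on elementary tensors with the corresponding map of \<open>F\<close> (\<open>lin_ext_emb\<close>).
\<close>

section \<open>Linear maps between free vector spaces\<close>

abbreviation flinear :: "(('a \<Rightarrow>\<^sub>0 'k::field) \<Rightarrow> ('b \<Rightarrow>\<^sub>0 'k)) \<Rightarrow> bool"
  where "flinear \<equiv> Vector_Spaces.linear fscale fscale"

lemma linear_intro:
  assumes "vector_space s1" "vector_space s2"
    and "\<And>x y. f (x + y) = f x + f y" "\<And>c x. f (s1 c x) = s2 c (f x)"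
  shows "Vector_Spaces.linear s1 s2 f"
  using assms by (simp add: Vector_Spaces.linear_iff)

lemma linear_plus: "Vector_Spaces.linear s1 s2 f \<Longrightarrow> f (x + y) = f x + f y"
  and linear_scale: "Vector_Spaces.linear s1 s2 f \<Longrightarrow> f (s1 c x) = s2 c (f x)"
  by (simp_all add: Vector_Spaces.linear_iff)

lemma linear_zero: "Vector_Spaces.linear s1 s2 f \<Longrightarrow> f 0 = 0"
  by (metis add_cancel_right_right linear_plus)

lemma linear_uminus: "Vector_Spaces.linear s1 s2 f \<Longrightarrow> f (- x) = - f x"
  by (metis add_eq_0_iff linear_plus linear_zero)

lemma linear_minus: "Vector_Spaces.linear s1 s2 f \<Longrightarrow> f (x - y) = f x - f y"
  by (metis diff_conv_add_uminus linear_plus linear_uminus)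

lemma linear_sum_distrib: "Vector_Spaces.linear s1 s2 f \<Longrightarrow> f (sum g I) = (\<Sum>i\<in>I. f (g i))"
  by (induction I rule: infinite_finite_induct) (simp_all add: linear_zero linear_plus)

lemmas linear_simps = linear_plus linear_scale linear_zero linear_uminus linear_minus linear_sum_distrib

lemma flinearI:
  assumes "\<And>x y. f (x + y) = f x + f y" "\<And>c x. f (fscale c x) = fscale c (f x)"
  shows "flinear f"
  using assms by (intro linear_intro free.vector_space_axioms) auto

lemma flinear_compose: "flinear G \<Longrightarrow> flinear F \<Longrightarrow> flinear (\<lambda>t. F (G t))"
  by (rule flinearI) (simp_all add: linear_simps)

lemma flinear_intros:
  "flinear (\<lambda>t. 0)"
  "flinear F \<Longrightarrow> flinear G \<Longrightarrow> flinear (\<lambda>t. F t + G t)"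
  "flinear F \<Longrightarrow> flinear G \<Longrightarrow> flinear (\<lambda>t. F t - G t)"
  "flinear F \<Longrightarrow> flinear (\<lambda>t. - F t)"
  "flinear F \<Longrightarrow> flinear (\<lambda>t. fscale c (F t))"
  by (rule flinearI; simp add: linear_simps free.scale_right_distrib free.scale_right_diff_distrib
      free.scale_left_commute)+

lemma poly_mapping_as_sum: "p = (\<Sum>a\<in>Poly_Mapping.keys p. fscale (Poly_Mapping.lookup p a) (gen a))"
proof (rule poly_mapping_eqI)
  fix b
  have "Poly_Mapping.lookup (\<Sum>a\<in>Poly_Mapping.keys p. fscale (Poly_Mapping.lookup p a) (gen a)) b
      = (\<Sum>a\<in>Poly_Mapping.keys p. if a = b then Poly_Mapping.lookup p a else 0)"
    by (simp add: lookup_sum lookup_fscale lookup_single when_def if_distrib cong: if_cong)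
  also have "\<dots> = Poly_Mapping.lookup p b"
    by (simp add: in_keys_iff)
  finally show "Poly_Mapping.lookup p b =
      Poly_Mapping.lookup (\<Sum>a\<in>Poly_Mapping.keys p. fscale (Poly_Mapping.lookup p a) (gen a)) b" ..
qed

lemma free_on_eq_span: "free_on A = free.span (gen ` A)"
proof (intro equalityI subsetI)
  fix p :: "'a \<Rightarrow>\<^sub>0 'k::field"
  assume "p \<in> free_on A"
  then have "Poly_Mapping.keys p \<subseteq> A" by (simp add: free_on_def)
  then have "(\<Sum>a\<in>Poly_Mapping.keys p. fscale (Poly_Mapping.lookup p a) (gen a)) \<in> free.span (gen ` A)"
    by (intro free.span_sum free.span_scale free.span_base) auto
  then show "p \<in> free.span (gen ` A)" by (metis poly_mapping_as_sum)
next
  have keys_fscale: "Poly_Mapping.keys (fscale c p) \<subseteq> Poly_Mapping.keys p"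
    for c and p :: "'a \<Rightarrow>\<^sub>0 'k::field"
    by (auto simp: in_keys_iff lookup_fscale)
  fix p :: "'a \<Rightarrow>\<^sub>0 'k::field"
  assume "p \<in> free.span (gen ` A)"
  then show "p \<in> free_on A"
  proof (induction rule: free.span_induct_alt)
    case base
    show ?case by (simp add: free_on_def)
  next
    case (step c x y)
    then obtain a where "x = gen a" "a \<in> A" by auto
    with step keys_fscale[of c x] Poly_Mapping.keys_add[of "fscale c x" y] show ?case
      unfolding free_on_def by (fastforce split: if_splits)
  qed
qed

lemma span_gen_UNIV: "free.span (range gen) = UNIV"
  using free_on_eq_span[of UNIV] by (auto simp: free_on_def)

lemma flinear_eqI:
  assumes "flinear F" "flinear G" "\<And>a. F (gen a) = G (gen a)"
  shows "F p = G p"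
proof -
  have "p \<in> free.span (range gen)" by (simp add: span_gen_UNIV)
  then show ?thesis
    by (induction rule: free.span_induct_alt) (use assms in \<open>auto simp: linear_simps\<close>)
qed

text \<open>The linear extension of a map given on the basis.\<close>

definition free_lift :: "('a \<Rightarrow> ('b \<Rightarrow>\<^sub>0 'k)) \<Rightarrow> ('a \<Rightarrow>\<^sub>0 'k::field) \<Rightarrow> ('b \<Rightarrow>\<^sub>0 'k)"
  where "free_lift g p = (\<Sum>a\<in>Poly_Mapping.keys p. fscale (Poly_Mapping.lookup p a) (g a))"

lemma free_lift_superset:
  assumes "finite S" "Poly_Mapping.keys p \<subseteq> S"
  shows "free_lift g p = (\<Sum>a\<in>S. fscale (Poly_Mapping.lookup p a) (g a))"
  unfolding free_lift_def using assms
  by (intro sum.mono_neutral_left) (auto simp: in_keys_iff)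

lemma flinear_free_lift:
  fixes g :: "'a \<Rightarrow> ('b \<Rightarrow>\<^sub>0 'k::field)"
  shows "flinear (free_lift g)"
proof (rule flinearI)
  fix p q :: "'a \<Rightarrow>\<^sub>0 'k"
  let ?S = "Poly_Mapping.keys p \<union> Poly_Mapping.keys q"
  have "Poly_Mapping.keys (p + q) \<subseteq> ?S" by (rule Poly_Mapping.keys_add)
  then show "free_lift g (p + q) = free_lift g p + free_lift g q"
    by (simp add: free_lift_superset[of ?S] lookup_add free.scale_left_distrib sum.distrib)
next
  fix c and p :: "'a \<Rightarrow>\<^sub>0 'k"
  have "Poly_Mapping.keys (fscale c p) \<subseteq> Poly_Mapping.keys p"
    by (auto simp: in_keys_iff lookup_fscale)
  then show "free_lift g (fscale c p) = fscale c (free_lift g p)"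
    by (simp add: free_lift_superset[of "Poly_Mapping.keys p"] lookup_fscale
        free.scale_sum_right)
qed

lemma free_lift_gen [simp]: "free_lift g (gen a) = g a"
  by (simp add: free_lift_def)

section \<open>Complements and quotients of vector spaces\<close>

context vector_space
begin

text \<open>A linear projection with kernel \<open>S\<close>: its image is a complement of \<open>S\<close>, hence a copy of the
  quotient by \<open>S\<close> inside the space itself.\<close>

lemma exists_projection_along:
  assumes "subspace S"
  shows "\<exists>\<pi>. Vector_Spaces.linear scale scale \<pi> \<and> (\<forall>t. \<pi> t = 0 \<longleftrightarrow> t \<in> S) \<and> (\<forall>t. t - \<pi> t \<in> S)"
proof -
  obtain B where B: "B \<subseteq> S" "independent B" "S \<subseteq> span B"
    by (rule maximal_independent_subset)
  have pair: "vector_space_pair scale scale"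
    by (intro vector_space_pair.intro vector_space_axioms)
  obtain \<pi> where lin: "Vector_Spaces.linear scale scale \<pi>"
    and on_basis: "\<forall>b\<in>extend_basis B. \<pi> b = (if b \<in> B then 0 else b)"
    using vector_space_pair.linear_independent_extend[OF pair independent_extend_basis[OF B(2)],
        of "\<lambda>b. if b \<in> B then 0 else b"] by blast
  have kills: "\<pi> t = 0" if "t \<in> S" for t
  proof -
    have "t \<in> span B" using B that by blast
    then show ?thesis
      by (induction rule: span_induct_alt)
        (use on_basis extend_basis_superset[OF B(2)] in \<open>auto simp: linear_simps[OF lin]\<close>)
  qed
  have diff: "t - \<pi> t \<in> S" for t
  proof -
    have "t \<in> span (extend_basis B)" by (simp add: span_extend_basis[OF B(2)])
    then show ?thesis
    proof (induction rule: span_induct_alt)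
      case base
      show ?case by (simp add: linear_simps[OF lin] subspace_0[OF assms])
    next
      case (step c x y)
      have "x - \<pi> x \<in> S" using on_basis step(1) B by (auto simp: subspace_0[OF assms])
      with step have "scale c (x - \<pi> x) + (y - \<pi> y) \<in> S"
        using subspace_add[OF assms] subspace_scale[OF assms] by blast
      then show ?case
        by (simp add: linear_simps[OF lin] scale_right_diff_distrib algebra_simps)
    qed
  qed
  have "t \<in> S" if "\<pi> t = 0" for t
    using diff[of t] that by simp
  with lin kills diff show ?thesis by blast
qed

lemma in_coset_iff: "x \<in> coset W y \<longleftrightarrow> x - y \<in> W"
proof
  assume "x - y \<in> W"
  then show "x \<in> coset W y" unfolding coset_def by (intro CollectI exI[of _ "x - y"]) simp
qed (auto simp: coset_def)

lemma coset_eq_iff: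
  assumes "subspace W"
  shows "coset W x = coset W y \<longleftrightarrow> x - y \<in> W"
proof
  assume "coset W x = coset W y"
  moreover have "x \<in> coset W x" by (simp add: in_coset_iff subspace_0[OF assms])
  ultimately show "x - y \<in> W" by (simp add: in_coset_iff)
next
  assume d: "x - y \<in> W"
  show "coset W x = coset W y"
  proof (rule Set.set_eqI)
    fix z
    have "z - y \<in> W" if "z - x \<in> W"
      using subspace_add[OF assms that d] by simp
    moreover have "z - x \<in> W" if "z - y \<in> W"
      using subspace_diff[OF assms that d] by simp
    ultimately show "z \<in> coset W x \<longleftrightarrow> z \<in> coset W y"
      by (auto simp: in_coset_iff)
  qed
qed

lemma coset_nonempty: "subspace W \<Longrightarrow> coset W x \<noteq> {}"
  using in_coset_iff[of x W x] subspace_0[of W] by force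

lemma quot_space_add:
  assumes "subspace W"
  shows "coset W x \<oplus>\<^bsub>quot_space scale U W\<^esub> coset W y = coset W (x + y)"
proof -
  have "coset W (x' + y') = coset W (x + y)" if "x' \<in> coset W x" "y' \<in> coset W y" for x' y'
    using subspace_add[OF assms, of "x' - x" "y' - y"] that
    by (simp add: coset_eq_iff[OF assms] in_coset_iff algebra_simps)
  then have "(\<Union>x'\<in>coset W x. \<Union>y'\<in>coset W y. coset W (x' + y')) =
      (\<Union>x'\<in>coset W x. \<Union>y'\<in>coset W y. coset W (x + y))"
    by (intro SUP_cong refl)
  then show ?thesis by (simp add: quot_space_def coset_nonempty[OF assms])
qed

lemma quot_space_smult:
  assumes "subspace W"
  shows "c \<odot>\<^bsub>quot_space scale U W\<^esub> coset W x = coset W (scale c x)"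
proof -
  have "coset W (scale c x') = coset W (scale c x)" if "x' \<in> coset W x" for x'
    using subspace_scale[OF assms, of "x' - x" c] that
    by (simp add: coset_eq_iff[OF assms] in_coset_iff scale_right_diff_distrib)
  then have "(\<Union>x'\<in>coset W x. coset W (scale c x')) = (\<Union>x'\<in>coset W x. coset W (scale c x))"
    by (intro SUP_cong refl)
  then show ?thesis by (simp add: quot_space_def coset_nonempty[OF assms])
qed

lemma quot_space_zero: "\<zero>\<^bsub>quot_space scale U W\<^esub> = coset W 0"
  and quot_space_carrier: "carrier (quot_space scale U W) = coset W ` U"
  by (simp_all add: quot_space_def)

lemma quot_space_abelian_group:
  assumes U: "subspace U" and W: "subspace W"
  shows "abelian_group (quot_space scale U W)"
proof (rule abelian_groupI)
  fix X assume "X \<in> carrier (quot_space scale U W)"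
  then obtain x where x: "X = coset W x" "x \<in> U" by (auto simp: quot_space_carrier)
  then show "\<exists>Y\<in>carrier (quot_space scale U W). Y \<oplus>\<^bsub>quot_space scale U W\<^esub> X = \<zero>\<^bsub>quot_space scale U W\<^esub>"
    by (intro bexI[of _ "coset W (- x)"])
      (auto simp: quot_space_add[OF W] quot_space_zero quot_space_carrier subspace_neg[OF U])
next
  fix X Y assume "X \<in> carrier (quot_space scale U W)" "Y \<in> carrier (quot_space scale U W)"
  then obtain x y where "X = coset W x" "x \<in> U" "Y = coset W y" "y \<in> U"
    by (auto simp: quot_space_carrier)
  then show "X \<oplus>\<^bsub>quot_space scale U W\<^esub> Y \<in> carrier (quot_space scale U W)"
    and "X \<oplus>\<^bsub>quot_space scale U W\<^esub> Y = Y \<oplus>\<^bsub>quot_space scale U W\<^esub> X"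
    by (simp_all add: quot_space_carrier quot_space_add[OF W] subspace_add[OF U] add.commute)
next
  show "\<zero>\<^bsub>quot_space scale U W\<^esub> \<in> carrier (quot_space scale U W)"
    by (simp add: quot_space_carrier quot_space_zero subspace_0[OF U])
next
  fix X Y Z
  assume "X \<in> carrier (quot_space scale U W)" "Y \<in> carrier (quot_space scale U W)"
    "Z \<in> carrier (quot_space scale U W)"
  then obtain x y z where "X = coset W x" "Y = coset W y" "Z = coset W z"
    by (auto simp: quot_space_carrier)
  then show "(X \<oplus>\<^bsub>quot_space scale U W\<^esub> Y) \<oplus>\<^bsub>quot_space scale U W\<^esub> Z =
      X \<oplus>\<^bsub>quot_space scale U W\<^esub> (Y \<oplus>\<^bsub>quot_space scale U W\<^esub> Z)"
    by (simp add: quot_space_add[OF W] add.assoc)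
next
  fix X assume "X \<in> carrier (quot_space scale U W)"
  then show "\<zero>\<^bsub>quot_space scale U W\<^esub> \<oplus>\<^bsub>quot_space scale U W\<^esub> X = X"
    by (auto simp: quot_space_carrier quot_space_zero quot_space_add[OF W])
qed


end

section \<open>Tensors as elements of one free space\<close>

locale tensor_exterior = L: vector_space scaleL + M: vector_space scaleM
  for scaleL :: "'k::field \<Rightarrow> 'l::ab_group_add \<Rightarrow> 'l"
    and scaleM :: "'k \<Rightarrow> 'm::ab_group_add \<Rightarrow> 'm"
begin

text \<open>Multilinear functions of \<open>m\<close> and of the entries of a list, for lists of all lengths at
  once.\<close>

definition multilinear :: "('m \<Rightarrow> 'l list \<Rightarrow> ('b \<Rightarrow>\<^sub>0 'k)) \<Rightarrow> bool"
  where "multilinear g \<longleftrightarrow>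
    (\<forall>xs. Vector_Spaces.linear scaleM fscale (\<lambda>m. g m xs)) \<and>
    (\<forall>m us vs. Vector_Spaces.linear scaleL fscale (\<lambda>x. g m (us @ x # vs)))"

text \<open>Multilinear functions that vanish on every list with a repeated entry.\<close>

definition alternating :: "('m \<Rightarrow> 'l list \<Rightarrow> ('b \<Rightarrow>\<^sub>0 'k)) \<Rightarrow> bool"
  where "alternating g \<longleftrightarrow> multilinear g \<and> (\<forall>m xs. \<not> distinct xs \<longrightarrow> g m xs = 0)"

lemma linear_fromL:
  assumes "\<And>x y. f (x + y) = f x + f y" "\<And>c x. f (scaleL c x) = fscale c (f x)"
  shows "Vector_Spaces.linear scaleL fscale f"
  using assms by (intro linear_intro free.vector_space_axioms L.vector_space_axioms) auto

lemma linear_fromM: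
  assumes "\<And>x y. f (x + y) = f x + f y" "\<And>c x. f (scaleM c x) = fscale c (f x)"
  shows "Vector_Spaces.linear scaleM fscale f"
  using assms by (intro linear_intro free.vector_space_axioms M.vector_space_axioms) auto

lemma multilinearI:
  assumes "\<And>m m' xs. g (m + m') xs = g m xs + g m' xs"
    and "\<And>c m xs. g (scaleM c m) xs = fscale c (g m xs)"
    and "\<And>m us x y vs. g m (us @ (x + y) # vs) = g m (us @ x # vs) + g m (us @ y # vs)"
    and "\<And>m us c x vs. g m (us @ scaleL c x # vs) = fscale c (g m (us @ x # vs))"
  shows "multilinear g"
  unfolding multilinear_def using assms by (intro conjI allI linear_fromL linear_fromM) auto

lemma multilinearD:
  assumes "multilinear g"
  shows "g (m + m') xs = g m xs + g m' xs"
    and "g (scaleM c m) xs = fscale c (g m xs)"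
    and "g m (us @ (x + y) # vs) = g m (us @ x # vs) + g m (us @ y # vs)"
    and "g m (us @ scaleL c x # vs) = fscale c (g m (us @ x # vs))"
proof -
  have M: "Vector_Spaces.linear scaleM fscale (\<lambda>m. g m xs)"
    and L: "Vector_Spaces.linear scaleL fscale (\<lambda>x. g m (us @ x # vs))"
    using assms unfolding multilinear_def by blast+
  show "g (m + m') xs = g m xs + g m' xs" "g (scaleM c m) xs = fscale c (g m xs)"
    using linear_plus[OF M] linear_scale[OF M] by simp_all
  show "g m (us @ (x + y) # vs) = g m (us @ x # vs) + g m (us @ y # vs)"
    and "g m (us @ scaleL c x # vs) = fscale c (g m (us @ x # vs))"
    using linear_plus[OF L] linear_scale[OF L] by simp_all
qed

text \<open>A function defined by recursion on the list is multilinear if the recursion is; the step may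
  add a multilinear term to a linear function of the value for the tail.\<close>

lemma multilinear_Cons_recursion:
  assumes nil: "Vector_Spaces.linear scaleM fscale (\<lambda>m. g m [])"
    and cons: "\<And>m z xs. g m (z # xs) = P z (g m xs) + Q z m xs"
    and P1: "\<And>z. flinear (P z)"
    and P2: "\<And>t. Vector_Spaces.linear scaleL fscale (\<lambda>z. P z t)"
    and Q1: "\<And>m xs. Vector_Spaces.linear scaleL fscale (\<lambda>z. Q z m xs)"
    and Q2: "\<And>z. multilinear (Q z)"
  shows "multilinear g"
proof (rule multilinearI)
  show "g (m + m') xs = g m xs + g m' xs" for m m' xs
    by (induction xs)
      (simp_all add: linear_simps[OF nil] cons linear_simps[OF P1] multilinearD[OF Q2])
  show "g (scaleM c m) xs = fscale c (g m xs)" for c m xs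
    by (induction xs)
      (simp_all add: linear_simps[OF nil] cons linear_simps[OF P1] multilinearD[OF Q2]
        free.scale_right_distrib)
  show "g m (us @ (x + y) # vs) = g m (us @ x # vs) + g m (us @ y # vs)" for m us x y vs
    by (induction us)
      (simp_all add: cons linear_simps[OF P1] linear_simps[OF P2] linear_simps[OF Q1]
        multilinearD[OF Q2])
  show "g m (us @ scaleL c x # vs) = fscale c (g m (us @ x # vs))" for m us c x vs
    by (induction us)
      (simp_all add: cons linear_simps[OF P1] linear_simps[OF P2] linear_simps[OF Q1]
        multilinearD[OF Q2] free.scale_right_distrib)
qed

lemma skew_of_square_zero:
  assumes g: "multilinear g" and sq: "\<And>z. g m (us @ z # z # vs) = 0"
  shows "g m (us @ x # y # vs) = - g m (us @ y # x # vs)"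
proof -
  have second: "g m (us @ a # (x + y) # vs) = g m (us @ a # x # vs) + g m (us @ a # y # vs)" for a
    using multilinearD(3)[OF g, of m "us @ [a]" x y vs] by simp
  have "0 = g m (us @ (x + y) # (x + y) # vs)" by (simp add: sq)
  also have "\<dots> = g m (us @ x # y # vs) + g m (us @ y # x # vs)"
    by (simp add: multilinearD(3)[OF g] second sq)
  finally show ?thesis by (metis eq_neg_iff_add_eq_0)
qed

text \<open>To vanish on lists with a repeated entry can be checked by recursion on the list, together
  with the case of two equal entries in front: if the first entry \<open>z\<close> is repeated in the tail, but
  not in the second place, exchanging the first two entries brings both occurrences of \<open>z\<close> into
  the tail.\<close>

lemma alternatingI:
  assumes g: "multilinear g"
    and sq: "\<And>m z xs. g m (z # z # xs) = 0"
    and step: "\<And>m z xs. \<lbrakk>\<not> distinct xs; g m xs = 0\<rbrakk> \<Longrightarrow> g m (z # xs) = 0"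
  shows "alternating g"
proof -
  have "g m xs = 0" if "\<not> distinct xs" for m xs
    using that
  proof (induction xs rule: length_induct)
    case (1 xs)
    then obtain z us where xs: "xs = z # us" by (cases xs) auto
    show ?case
    proof (cases "distinct us")
      case False
      with 1(1) xs show ?thesis by (simp add: step)
    next
      case True
      with 1(2) xs have "z \<in> set us" by simp
      then obtain ps qs where us: "us = ps @ z # qs" by (meson split_list)
      show ?thesis
      proof (cases ps)
        case Nil
        then show ?thesis by (simp add: xs us sq)
      next
        case (Cons a ps')
        have "g m (z # ps' @ z # qs) = 0" using 1(1) xs us Cons by simp
        then have "g m (a # z # ps' @ z # qs) = 0" by (simp add: step)
        moreover have "g m xs = - g m (a # z # ps' @ z # qs)"
          using skew_of_square_zero[OF g, of m "[]" "ps' @ z # qs" z a] by (simp add: sq xs us Cons)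
        ultimately show ?thesis by simp
      qed
    qed
  qed
  with g show ?thesis by (simp add: alternating_def)
qed

text \<open>The relations that present the sum over all \<open>n\<close> of the spaces \<open>M \<otimes> \<Lambda>\<^sup>n L\<close>, in one step, as
  a quotient of the free space on pairs of an element and a list.\<close>

definition rels :: "('m \<times> 'l list \<Rightarrow>\<^sub>0 'k) set"
  where "rels =
    {gen (m + m', xs) - gen (m, xs) - gen (m', xs) | m m' xs. True} \<union>
    {gen (scaleM c m, xs) - fscale c (gen (m, xs)) | c m xs. True} \<union>
    {gen (m, us @ (x + y) # vs) - gen (m, us @ x # vs) - gen (m, us @ y # vs) | m us x y vs. True} \<union>
    {gen (m, us @ scaleL c x # vs) - fscale c (gen (m, us @ x # vs)) | m us c x vs. True} \<union>
    {gen (m, xs) | m xs. \<not> distinct xs}"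

lemma relsI:
  "gen (m + m', xs) - gen (m, xs) - gen (m', xs) \<in> rels"
  "gen (scaleM c m, xs) - fscale c (gen (m, xs)) \<in> rels"
  "gen (m, us @ (x + y) # vs) - gen (m, us @ x # vs) - gen (m, us @ y # vs) \<in> rels"
  "gen (m, us @ scaleL c x # vs) - fscale c (gen (m, us @ x # vs)) \<in> rels"
  "\<not> distinct xs \<Longrightarrow> gen (m, xs) \<in> rels"
  unfolding rels_def by blast+

text \<open>A projection with kernel spanned by the relations. Its image stands for the quotient; the
  choice of the complement does not matter.\<close>

definition proj :: "('m \<times> 'l list \<Rightarrow>\<^sub>0 'k) \<Rightarrow> ('m \<times> 'l list \<Rightarrow>\<^sub>0 'k)"
  where "proj = (SOME \<pi>. flinear \<pi> \<and> (\<forall>t. \<pi> t = 0 \<longleftrightarrow> t \<in> free.span rels) \<and>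
    (\<forall>t. t - \<pi> t \<in> free.span rels))"

lemma proj:
  shows linear_proj: "flinear proj"
    and proj_eq_0_iff: "proj t = 0 \<longleftrightarrow> t \<in> free.span rels"
    and diff_proj: "t - proj t \<in> free.span rels"
  using someI_ex[OF free.exists_projection_along[OF free.subspace_span, of rels]]
  unfolding proj_def by blast+

lemmas proj_simps = linear_simps[OF linear_proj]

text \<open>The tensor \<open>m \<otimes> x\<^sub>1 \<and> \<dots> \<and> x\<^sub>n\<close> in this model.\<close>

definition pure :: "'m \<Rightarrow> 'l list \<Rightarrow> ('m \<times> 'l list \<Rightarrow>\<^sub>0 'k)"
  where "pure m xs = proj (gen (m, xs))"

text \<open>The linear map on the free space with the values \<open>g m xs\<close> on the basis. If \<open>g\<close> is alternating,
  it kills the relations, so it takes the same values on the tensors \<open>pure m xs\<close>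
  (\<open>induced_pure\<close>).\<close>

definition induced :: "('m \<Rightarrow> 'l list \<Rightarrow> ('b \<Rightarrow>\<^sub>0 'k)) \<Rightarrow> ('m \<times> 'l list \<Rightarrow>\<^sub>0 'k) \<Rightarrow> ('b \<Rightarrow>\<^sub>0 'k)"
  where "induced g = free_lift (\<lambda>(m, xs). g m xs)"

lemma linear_induced: "flinear (induced g)"
  unfolding induced_def by (rule flinear_free_lift)

lemmas induced_simps = linear_simps[OF linear_induced]

lemma induced_gen: "induced g (gen (m, xs)) = g m xs"
  by (simp add: induced_def)

lemma rel_zero: "r \<in> rels \<Longrightarrow> proj r = 0"
  by (simp add: proj_eq_0_iff free.span_base)

lemma pure_alternating: "alternating pure"
  unfolding alternating_def
proof (intro conjI allI impI multilinearI)
  fix m m' xs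
  have "proj (gen (m + m', xs) - gen (m, xs) - gen (m', xs)) = 0"
    by (intro rel_zero relsI)
  then show "pure (m + m') xs = pure m xs + pure m' xs"
    by (simp add: pure_def proj_simps algebra_simps)
next
  fix c m xs
  have "proj (gen (scaleM c m, xs) - fscale c (gen (m, xs))) = 0"
    by (intro rel_zero relsI)
  then show "pure (scaleM c m) xs = fscale c (pure m xs)"
    by (simp add: pure_def proj_simps)
next
  fix m us x y vs
  have "proj (gen (m, us @ (x + y) # vs) - gen (m, us @ x # vs) - gen (m, us @ y # vs)) = 0"
    by (intro rel_zero relsI)
  then show "pure m (us @ (x + y) # vs) = pure m (us @ x # vs) + pure m (us @ y # vs)"
    by (simp add: pure_def proj_simps algebra_simps)
next
  fix m us c x vs
  have "proj (gen (m, us @ scaleL c x # vs) - fscale c (gen (m, us @ x # vs))) = 0"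
    by (intro rel_zero relsI)
  then show "pure m (us @ scaleL c x # vs) = fscale c (pure m (us @ x # vs))"
    by (simp add: pure_def proj_simps)
next
  fix m xs
  assume "\<not> distinct (xs :: 'l list)"
  then show "pure m xs = 0"
    unfolding pure_def by (intro rel_zero relsI)
qed

lemma pure_multilinear: "multilinear pure"
  using pure_alternating by (simp add: alternating_def)

lemma pure_not_distinct: "\<not> distinct xs \<Longrightarrow> pure m xs = 0"
  using pure_alternating by (simp add: alternating_def)

lemmas pure_simps = multilinearD[OF pure_multilinear]
  multilinearD(3,4)[OF pure_multilinear, where us = "[]", simplified]
  multilinearD(3,4)[OF pure_multilinear, where us = "z # us" for z us, simplified]

lemma pure_uminus: "pure (- m) xs = - pure m xs"
  using pure_simps(2)[of "-1" m xs] by simp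

lemma pure_uminus_head: "pure m ((- x) # xs) = - pure m (x # xs)"
  using pure_simps(4)[of m "[]" "-1" x xs] by simp

lemma pure_diff: "pure (m - m') xs = pure m xs - pure m' xs"
  using pure_simps(1)[of m "- m'" xs] by (simp add: pure_uminus)

lemma pure_zero_head: "pure m (0 # xs) = 0"
  using pure_simps(4)[of m "[]" 0 0 xs] by simp

lemma pure_swap: "pure m (us @ x # y # vs) = - pure m (us @ y # x # vs)"
  by (rule skew_of_square_zero[OF pure_multilinear]) (simp add: pure_not_distinct)

lemma pure_rotate: "pure m (us @ xs @ [y]) = fscale ((-1) ^ length xs) (pure m (us @ y # xs))"
proof (induction xs arbitrary: us)
  case (Cons x xs)
  have "pure m (us @ (x # xs) @ [y]) = fscale ((-1) ^ length xs) (pure m (us @ x # y # xs))"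
    using Cons[of "us @ [x]"] by simp
  then show ?case using pure_swap[of m us x y xs] by simp
qed simp

lemma induced_pure:
  assumes g: "alternating g"
  shows "induced g (pure m xs) = g m xs"
proof -
  have lin: "multilinear g" and alt: "\<And>m xs. \<not> distinct xs \<Longrightarrow> g m xs = 0"
    using g by (auto simp: alternating_def)
  have "induced g t = 0" if "t \<in> free.span rels" for t
    using that
  proof (induction rule: free.span_induct_alt)
    case (step c x y)
    have "induced g x = 0"
      using step(1) unfolding rels_def
      by (auto simp: induced_simps induced_gen multilinearD[OF lin] alt)
    with step show ?case by (simp add: induced_simps)
  qed (simp add: induced_simps)
  from this[OF diff_proj, of "gen (m, xs)"] show ?thesis
    by (simp add: induced_simps induced_gen pure_def)
qed

text \<open>Wedging with \<open>z\<close> in the first place.\<close>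

definition ins :: "'l \<Rightarrow> ('m \<times> 'l list \<Rightarrow>\<^sub>0 'k) \<Rightarrow> ('m \<times> 'l list \<Rightarrow>\<^sub>0 'k)"
  where "ins z = induced (\<lambda>m xs. pure m (z # xs))"

lemma flinear_ins: "flinear (ins z)"
  unfolding ins_def by (rule linear_induced)

lemmas ins_simps = linear_simps[OF flinear_ins]

lemma ins_alternating: "alternating (\<lambda>m xs. pure m (z # xs))"
  unfolding alternating_def
  by (auto intro!: multilinearI simp: pure_simps pure_not_distinct)

lemma ins_gen [simp]: "ins z (gen (m, xs)) = pure m (z # xs)"
  by (simp add: ins_def induced_gen)

lemma ins_pure [simp]: "ins z (pure m xs) = pure m (z # xs)"
  unfolding ins_def by (rule induced_pure[OF ins_alternating])

lemma flinear_eqI_gen: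
  assumes "flinear F" "flinear G" "\<And>m xs. F (gen (m, xs)) = G (gen (m, xs))"
  shows "F t = G t"
proof (rule flinear_eqI[OF assms(1,2)])
  show "F (gen a) = G (gen a)" for a using assms(3) by (cases a) simp
qed

lemma linear_ins_index: "Vector_Spaces.linear scaleL fscale (\<lambda>z. ins z t)"
proof (rule linear_fromL)
  show "ins (x + y) t = ins x t + ins y t" for x y
    by (rule flinear_eqI_gen[where F = "ins (x + y)" and G = "\<lambda>t. ins x t + ins y t"])
      (rule flinear_intros flinear_ins | simp add: pure_simps)+
  show "ins (scaleL c x) t = fscale c (ins x t)" for c x
    by (rule flinear_eqI_gen[where F = "ins (scaleL c x)" and G = "\<lambda>t. fscale c (ins x t)"])
      (rule flinear_intros flinear_ins | simp add: pure_simps)+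
qed

lemmas ins_index_simps = linear_simps[OF linear_ins_index]

lemma ins_ins: "ins z (ins z t) = 0"
  by (rule flinear_eqI_gen[where F = "\<lambda>t. ins z (ins z t)" and G = "\<lambda>t. 0"])
    (rule flinear_intros flinear_compose[OF flinear_ins flinear_ins] | simp add: pure_not_distinct)+

end

section \<open>The operators of the Hom-Lie complex\<close>

sublocale right_hom_module \<subseteq> tensor_exterior scaleL scaleM ..

text \<open>A module over a Hom-Lie algebra in characteristic other than \<open>2\<close>.\<close>

locale hom_chains = right_hom_module scaleL br \<alpha>L scaleM act \<alpha>M
  for scaleL :: "'k::field \<Rightarrow> 'l::ab_group_add \<Rightarrow> 'l" and br and \<alpha>L
    and scaleM :: "'k \<Rightarrow> 'm::ab_group_add \<Rightarrow> 'm" and act and \<alpha>M +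
  assumes char_not_2: "CHAR('k) \<noteq> 2"
begin

lemma br_self: "br z z = 0"
proof -
  have two: "(2::'k) \<noteq> 0"
  proof
    assume "(2::'k) = 0"
    then have "of_nat 2 = (0::'k)" by simp
    then have "CHAR('k) dvd 2" by (simp only: of_nat_eq_0_iff_char_dvd)
    then have "CHAR('k) \<noteq> 0" "CHAR('k) \<le> 2" by (auto dest: dvd_imp_le intro!: Nat.gr0I)
    with char_not_2 have "CHAR('k) = 1" by linarith
    then show False using of_nat_CHAR[where 'a = 'k] by simp
  qed
  have "scaleL 2 (br z z) = br z z + br z z"
    using L.scale_left_distrib[of 1 1 "br z z"] by simp
  also have "\<dots> = 0" using br_skew[of z z] by (metis add.right_inverse)
  finally show ?thesis using two by simp
qed

lemmas br_simps = linear_simps[OF br_linear_left] linear_simps[OF br_linear_right]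
lemmas act_simps = linear_simps[OF act_linear_left] linear_simps[OF act_linear_right]
lemmas alpha_simps = linear_simps[OF \<alpha>L_linear] linear_simps[OF \<alpha>M_linear]

text \<open>The map \<open>\<alpha>\<^sub>M \<otimes> \<alpha>\<^sub>L\<^sup>\<and>\<^sup>n\<close>, in all degrees \<open>n\<close> together.\<close>

definition tw :: "('m \<times> 'l list \<Rightarrow>\<^sub>0 'k) \<Rightarrow> ('m \<times> 'l list \<Rightarrow>\<^sub>0 'k)"
  where "tw = induced (\<lambda>m xs. pure (\<alpha>M m) (map \<alpha>L xs))"

lemma tw_alternating: "alternating (\<lambda>m xs. pure (\<alpha>M m) (map \<alpha>L xs))"
  unfolding alternating_def
  by (auto intro!: multilinearI pure_not_distinct simp: alpha_simps pure_simps distinct_map)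

lemma flinear_tw: "flinear tw"
  unfolding tw_def by (rule linear_induced)

lemma tw_gen [simp]: "tw (gen (m, xs)) = pure (\<alpha>M m) (map \<alpha>L xs)"
  by (simp add: tw_def induced_gen)

lemma tw_pure [simp]: "tw (pure m xs) = pure (\<alpha>M m) (map \<alpha>L xs)"
  unfolding tw_def by (rule induced_pure[OF tw_alternating])

lemmas tw_simps = linear_simps[OF flinear_tw]

text \<open>The values of \<open>\<theta>(y)\<close> on elementary tensors, with indices from \<open>0\<close>.\<close>

definition lie_fun :: "'l \<Rightarrow> 'm \<Rightarrow> 'l list \<Rightarrow> ('m \<times> 'l list \<Rightarrow>\<^sub>0 'k)"
  where "lie_fun y m xs = - pure (act m y) (map \<alpha>L xs) +
    (\<Sum>i<length xs. fscale ((-1) ^ (i + 1))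
      (pure (\<alpha>M m) (br (xs ! i) y # nths (map \<alpha>L xs) (- {i}))))"

text \<open>The values of the differential on elementary tensors.\<close>

definition bd_fun :: "'m \<Rightarrow> 'l list \<Rightarrow> ('m \<times> 'l list \<Rightarrow>\<^sub>0 'k)"
  where "bd_fun m xs =
    (\<Sum>i<length xs. fscale ((-1) ^ i) (pure (act m (xs ! i)) (nths (map \<alpha>L xs) (- {i})))) +
    (\<Sum>j<length xs. \<Sum>i<j. fscale ((-1) ^ (i + j))
      (pure (\<alpha>M m) (br (xs ! i) (xs ! j) # nths (map \<alpha>L xs) (- {i, j}))))"

lemma nths_Cons_omit:
  "nths (a # xs) (- {0}) = xs"
  "nths (a # xs) (- {Suc i}) = a # nths xs (- {i})"
  "nths (a # xs) (- {0, Suc j}) = nths xs (- {j})"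
  "nths (a # xs) (- {Suc i, Suc j}) = a # nths xs (- {i, j})"
proof -
  have "{j. Suc j \<in> - {0}} = UNIV" "{j. Suc j \<in> - {Suc i}} = - {i}"
    "{i. Suc i \<in> - {0, Suc j}} = - {j}" "{k. Suc k \<in> - {Suc i, Suc j}} = - {i, j}"
    by auto
  then show "nths (a # xs) (- {0}) = xs" "nths (a # xs) (- {Suc i}) = a # nths xs (- {i})"
    "nths (a # xs) (- {0, Suc j}) = nths xs (- {j})"
    "nths (a # xs) (- {Suc i, Suc j}) = a # nths xs (- {i, j})"
    by (simp_all only: nths_Cons) (simp_all add: nths_all)
qed

lemma lie_fun_Nil: "lie_fun y m [] = - pure (act m y) []"
  by (simp add: lie_fun_def)

lemma pure_br_swap:
  "pure m (br a b # \<alpha>L z # ws) = - pure m (\<alpha>L z # br a b # ws)"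
  using pure_swap[of m "[]" "br a b" "\<alpha>L z" ws] by simp

lemma pure_br_skew: "pure m (br a b # ws) = - pure m (br b a # ws)"
  by (subst br_skew) (rule pure_uminus_head)

lemma lie_fun_Cons:
  "lie_fun y m (z # xs) = ins (\<alpha>L z) (lie_fun y m xs) + pure (\<alpha>M m) (br y z # map \<alpha>L xs)"
  unfolding lie_fun_def length_Cons sum.lessThan_Suc_shift nth_Cons_0 nth_Cons_Suc list.map
    nths_Cons_omit pure_br_swap pure_br_skew[of _ z y]
  by (simp add: ins_simps sum_negf)

lemma bd_fun_Nil: "bd_fun m [] = 0"
  by (simp add: bd_fun_def)

lemma bd_fun_Cons: "bd_fun m (z # xs) = - ins (\<alpha>L z) (bd_fun m xs) - lie_fun z m xs"
  unfolding bd_fun_def lie_fun_def length_Cons sum.lessThan_Suc_shift nth_Cons_0 nth_Cons_Suc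
    list.map nths_Cons_omit pure_br_swap pure_br_skew[of _ z]
  by (simp add: ins_simps sum_negf sum.distrib sum_subtractf)

lemma linear_lie_fun_index: "Vector_Spaces.linear scaleL fscale (\<lambda>y. lie_fun y m xs)"
proof (induction xs)
  case Nil
  show ?case
    by (rule linear_fromL) (simp_all add: lie_fun_Nil act_simps pure_simps)
next
  case (Cons z xs)
  show ?case
    by (rule linear_fromL)
      (simp_all add: lie_fun_Cons linear_simps[OF Cons] ins_simps br_simps pure_simps
        free.scale_right_distrib)
qed

lemmas lie_fun_index_simps = linear_simps[OF linear_lie_fun_index]

lemma lie_fun_multilinear: "multilinear (lie_fun y)"
proof (rule multilinear_Cons_recursion[where P = "\<lambda>z. ins (\<alpha>L z)"
      and Q = "\<lambda>z m xs. pure (\<alpha>M m) (br y z # map \<alpha>L xs)"])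
  show "Vector_Spaces.linear scaleM fscale (\<lambda>m. lie_fun y m [])"
    by (rule linear_fromM) (simp_all add: lie_fun_Nil act_simps pure_simps)
  show "Vector_Spaces.linear scaleL fscale (\<lambda>z. ins (\<alpha>L z) t)" for t
    by (rule linear_fromL) (simp_all add: alpha_simps ins_index_simps)
  show "Vector_Spaces.linear scaleL fscale (\<lambda>z. pure (\<alpha>M m) (br y z # map \<alpha>L xs))" for m xs
    by (rule linear_fromL) (simp_all add: br_simps pure_simps)
  show "multilinear (\<lambda>m xs. pure (\<alpha>M m) (br y z # map \<alpha>L xs))" for z
    by (rule multilinearI) (simp_all add: alpha_simps pure_simps)
qed (rule lie_fun_Cons flinear_ins)+

text \<open>The two terms that are produced by equal entries \<open>z, z\<close> in front are
  \<open>\<alpha> z \<and> [y, z] \<and> \<dots>\<close> and \<open>[y, z] \<and> \<alpha> z \<and> \<dots>\<close>; they cancel.\<close>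

lemma lie_fun_alternating: "alternating (lie_fun y)"
proof (rule alternatingI[OF lie_fun_multilinear])
  show "lie_fun y m (z # z # xs) = 0" for m z xs
    using pure_br_swap[of "\<alpha>M m" y z z "map \<alpha>L xs"]
    by (simp add: lie_fun_Cons ins_simps ins_ins)
  show "lie_fun y m (z # xs) = 0" if "\<not> distinct xs" "lie_fun y m xs = 0" for m z xs
    using that by (simp add: lie_fun_Cons ins_simps pure_not_distinct distinct_map)
qed

lemma bd_fun_multilinear: "multilinear bd_fun"
proof (rule multilinear_Cons_recursion[where P = "\<lambda>z t. - ins (\<alpha>L z) t"
      and Q = "\<lambda>z m xs. - lie_fun z m xs"])
  show "Vector_Spaces.linear scaleM fscale (\<lambda>m. bd_fun m [])"
    by (rule linear_fromM) (simp_all add: bd_fun_Nil)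
  show "bd_fun m (z # xs) = - ins (\<alpha>L z) (bd_fun m xs) + - lie_fun z m xs" for m z xs
    by (simp add: bd_fun_Cons)
  show "flinear (\<lambda>t. - ins (\<alpha>L z) t)" for z
    by (intro flinear_intros flinear_ins)
  show "Vector_Spaces.linear scaleL fscale (\<lambda>z. - ins (\<alpha>L z) t)" for t
    by (rule linear_fromL) (simp_all add: alpha_simps ins_index_simps)
  show "Vector_Spaces.linear scaleL fscale (\<lambda>z. - lie_fun z m xs)" for m xs
    by (rule linear_fromL) (simp_all add: lie_fun_index_simps)
  show "multilinear (\<lambda>m xs. - lie_fun z m xs)" for z
    by (rule multilinearI) (simp_all add: multilinearD[OF lie_fun_multilinear])
qed

text \<open>Here the terms that come from equal entries in front cancel up to one that contains
  \<open>[z, z]\<close>; this is where the characteristic enters.\<close>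

lemma bd_fun_alternating: "alternating bd_fun"
proof (rule alternatingI[OF bd_fun_multilinear])
  show "bd_fun m (z # z # xs) = 0" for m z xs
    by (simp add: bd_fun_Cons lie_fun_Cons ins_simps ins_ins br_self pure_zero_head)
  show "bd_fun m (z # xs) = 0" if "\<not> distinct xs" "bd_fun m xs = 0" for m z xs
    using that lie_fun_alternating by (simp add: bd_fun_Cons ins_simps alternating_def)
qed

text \<open>The operator \<open>\<theta>(y)\<close>, in all degrees together.\<close>

definition lie :: "'l \<Rightarrow> ('m \<times> 'l list \<Rightarrow>\<^sub>0 'k) \<Rightarrow> ('m \<times> 'l list \<Rightarrow>\<^sub>0 'k)"
  where "lie y = induced (lie_fun y)"

text \<open>The differential, in all degrees together; in degree \<open>0\<close> it is zero.\<close>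

definition bd :: "('m \<times> 'l list \<Rightarrow>\<^sub>0 'k) \<Rightarrow> ('m \<times> 'l list \<Rightarrow>\<^sub>0 'k)"
  where "bd = induced bd_fun"

lemma flinear_lie: "flinear (lie y)"
  unfolding lie_def by (rule linear_induced)

lemma flinear_bd: "flinear bd"
  unfolding bd_def by (rule linear_induced)

lemmas lie_simps = linear_simps[OF flinear_lie]
lemmas bd_simps = linear_simps[OF flinear_bd]

lemma lie_gen: "lie y (gen (m, xs)) = lie_fun y m xs"
  by (simp add: lie_def induced_gen)

lemma lie_pure: "lie y (pure m xs) = lie_fun y m xs"
  unfolding lie_def by (rule induced_pure[OF lie_fun_alternating])

lemma bd_gen: "bd (gen (m, xs)) = bd_fun m xs"
  by (simp add: bd_def induced_gen)

lemma bd_pure: "bd (pure m xs) = bd_fun m xs"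
  unfolding bd_def by (rule induced_pure[OF bd_fun_alternating])

lemmas flinear_ops = flinear_intros flinear_ins flinear_tw flinear_lie flinear_bd
  flinear_compose[OF _ flinear_ins] flinear_compose[OF _ flinear_tw]
  flinear_compose[OF _ flinear_lie] flinear_compose[OF _ flinear_bd]

section \<open>The Cartan formulas in the free space\<close>

lemma tw_ins: "tw (ins z t) = ins (\<alpha>L z) (tw t)"
  by (rule flinear_eqI_gen[where F = "\<lambda>t. tw (ins z t)" and G = "\<lambda>t. ins (\<alpha>L z) (tw t)"])
    (rule flinear_ops | simp)+

lemma lie_ins: "lie x (ins y t) = ins (\<alpha>L y) (lie x t) + ins (br x y) (tw t)"
  by (rule flinear_eqI_gen[where F = "\<lambda>t. lie x (ins y t)"
        and G = "\<lambda>t. ins (\<alpha>L y) (lie x t) + ins (br x y) (tw t)"])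
    (rule flinear_ops | simp add: lie_pure lie_gen lie_fun_Cons)+

lemma bd_ins: "bd (ins y t) = - ins (\<alpha>L y) (bd t) - lie y t"
  by (rule flinear_eqI_gen[where F = "\<lambda>t. bd (ins y t)"
        and G = "\<lambda>t. - ins (\<alpha>L y) (bd t) - lie y t"])
    (rule flinear_ops | simp add: bd_pure bd_gen bd_fun_Cons lie_gen)+

text \<open>Induction on the degree: a linear map that factors through the projection is zero if it
  vanishes in degree \<open>0\<close> and if its vanishing at a tensor persists under insertions.\<close>

lemma flinear_eqI_ins:
  assumes F: "flinear F" "\<And>t. F (proj t) = F t"
    and base: "\<And>m. F (pure m []) = 0"
    and step: "\<And>z t. F t = 0 \<Longrightarrow> F (ins z t) = 0"
  shows "F t = 0"
proof -
  have "F (pure m xs) = 0" for m xs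
  proof (induction xs)
    case (Cons z xs)
    then show ?case using step[of "pure m xs" z] by simp
  qed (rule base)
  then have "F (gen (m, xs)) = 0" for m xs
    using F(2)[of "gen (m, xs)"] by (simp add: pure_def)
  then show ?thesis
    using F(1) by (rule flinear_eqI_gen[where F = F and G = "\<lambda>t. 0", rotated 2])
      (rule flinear_intros)
qed

lemma induced_proj: 
  assumes "alternating g" 
  shows "induced g (proj t) = induced g t"
  by (rule flinear_eqI_gen[where F = "\<lambda>t. induced g (proj t)" and G = "induced g"])
    (rule flinear_compose[OF linear_proj] linear_induced
      | simp add: induced_gen induced_pure[OF assms, unfolded pure_def])+

lemmas op_proj = induced_proj[OF tw_alternating, folded tw_def]
  induced_proj[OF lie_fun_alternating, folded lie_def]
  induced_proj[OF bd_fun_alternating, folded bd_def]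

lemma lie_tw: "lie (\<alpha>L y) (tw t) = tw (lie y t)"
proof -
  have "lie (\<alpha>L y) (tw t) - tw (lie y t) = 0"
    by (rule flinear_eqI_ins[where F = "\<lambda>t. lie (\<alpha>L y) (tw t) - tw (lie y t)"])
      (rule flinear_ops | simp add: op_proj lie_pure lie_fun_Nil tw_simps \<alpha>M_act
        tw_ins lie_ins ins_simps \<alpha>L_br)+
  then show ?thesis by simp
qed

lemma bd_tw: "bd (tw t) = tw (bd t)"
proof -
  have "bd (tw t) - tw (bd t) = 0"
    by (rule flinear_eqI_ins[where F = "\<lambda>t. bd (tw t) - tw (bd t)"])
      (rule flinear_ops | simp add: op_proj bd_pure bd_fun_Nil tw_simps 
        tw_ins bd_ins ins_simps lie_tw)+
  then show ?thesis by simp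
qed

lemma lie_lie: "lie (\<alpha>L x) (lie y t) - lie (\<alpha>L y) (lie x t) = lie (br x y) (tw t)"
proof -
  let ?F = "\<lambda>t. lie (\<alpha>L x) (lie y t) - lie (\<alpha>L y) (lie x t) - lie (br x y) (tw t)"
  have "?F t = 0"
  proof (rule flinear_eqI_ins[where F = ?F])
    show "flinear ?F" by (rule flinear_ops)+
    show "?F (proj t) = ?F t" for t by (simp add: op_proj)
    show "?F (pure m []) = 0" for m
      by (simp add: lie_pure lie_fun_Nil lie_simps act_br act_simps pure_uminus pure_diff)
    fix z t
    assume IH: "?F t = 0"
    \<comment> \<open>The Hom-Jacobi identity, as the statement that the bracket is a right action on \<open>L\<close>.\<close>
    have "br (\<alpha>L x) (br y z) - br (\<alpha>L y) (br x z) - br (br x y) (\<alpha>L z) = 0"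
      using hom_jacobi[of x y z] br_skew[of "br x y" "\<alpha>L z"]
      unfolding br_skew[of z x] by (simp add: br_simps algebra_simps)
    then have "br (\<alpha>L x) (br y z) = br (\<alpha>L y) (br x z) + br (br x y) (\<alpha>L z)"
      by (simp add: algebra_simps)
    then have "ins (br (\<alpha>L x) (br y z)) w = ins (br (\<alpha>L y) (br x z)) w + ins (br (br x y) (\<alpha>L z)) w" for w
      by (simp add: ins_index_simps)
    then show "?F (ins z t) = 0"
      using arg_cong[OF IH, of "ins (\<alpha>L (\<alpha>L z))"]
      by (simp add: lie_ins lie_simps tw_ins ins_simps \<alpha>L_br lie_tw algebra_simps)
  qed
  then show ?thesis by simp
qed

lemma lie_bd: "lie (\<alpha>L y) (bd t) = bd (lie y t)"
proof -
  let ?F = "\<lambda>t. lie (\<alpha>L y) (bd t) - bd (lie y t)"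
  have "?F t = 0"
  proof (rule flinear_eqI_ins[where F = ?F])
    show "flinear ?F" by (rule flinear_ops)+
    show "?F (proj t) = ?F t" for t by (simp add: op_proj)
    show "?F (pure m []) = 0" for m
      by (simp add: bd_pure bd_fun_Nil lie_pure lie_fun_Nil lie_simps bd_simps)
    fix z t
    assume IH: "?F t = 0"
    then show "?F (ins z t) = 0"
      using lie_lie[of y z t]
      by (simp add: lie_ins bd_ins lie_simps bd_simps ins_simps \<alpha>L_br bd_tw algebra_simps)
  qed
  then show ?thesis by simp
qed

lemma bd_bd: "bd (bd t) = 0"
proof (rule flinear_eqI_ins[where F = "\<lambda>t. bd (bd t)"])
  show "flinear (\<lambda>t. bd (bd t))" by (rule flinear_ops)+
qed (simp_all add: op_proj bd_pure bd_fun_Nil bd_simps bd_ins lie_bd ins_simps)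

end

section \<open>The chain spaces inside the free space\<close>

context tensor_exterior
begin

text \<open>The classes of formal combinations in \<open>\<Lambda>\<^sup>n L\<close> and in \<open>M \<otimes> \<Lambda>\<^sup>n L\<close>.\<close>

abbreviation ext_class :: "nat \<Rightarrow> ('l list \<Rightarrow>\<^sub>0 'k) \<Rightarrow> ('l list \<Rightarrow>\<^sub>0 'k) set"
  where "ext_class n \<equiv> coset (free.span (ext_rels scaleL n))"

abbreviation chain_rels :: "nat \<Rightarrow> ('m \<times> ('l list \<Rightarrow>\<^sub>0 'k) set \<Rightarrow>\<^sub>0 'k) set"
  where "chain_rels n \<equiv> tensor_rels scaleM (ext_power scaleL n)"

abbreviation chain_class ::
    "nat \<Rightarrow> ('m \<times> ('l list \<Rightarrow>\<^sub>0 'k) set \<Rightarrow>\<^sub>0 'k) \<Rightarrow> ('k, 'l, 'm) chain"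
  where "chain_class n \<equiv> coset (free.span (chain_rels n))"

abbreviation C :: "nat \<Rightarrow> ('k, ('k, 'l, 'm) chain) module"
  where "C \<equiv> chain_space scaleL scaleM"

lemmas ext_class_eq_iff = free.coset_eq_iff[OF free.subspace_span]

lemma subspace_free_on: "free.subspace (free_on A)"
  by (simp add: free_on_eq_span free.subspace_span)

lemma ext_power_simps:
  "ext_class n p \<oplus>\<^bsub>ext_power scaleL n\<^esub> ext_class n q = ext_class n (p + q)"
  "c \<odot>\<^bsub>ext_power scaleL n\<^esub> ext_class n p = ext_class n (fscale c p)"
  "carrier (ext_power scaleL n) = ext_class n ` free_on {xs. length xs = n}"
  by (simp_all add: ext_power_def free.quot_space_add free.quot_space_smult
      free.quot_space_carrier free.subspace_span)

lemma chain_space_simps: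
  "chain_class n p \<oplus>\<^bsub>C n\<^esub> chain_class n q = chain_class n (p + q)"
  "c \<odot>\<^bsub>C n\<^esub> chain_class n p = chain_class n (fscale c p)"
  "carrier (C n) = chain_class n ` free_on (UNIV \<times> carrier (ext_power scaleL n))"
  "\<zero>\<^bsub>C n\<^esub> = chain_class n 0"
  by (simp_all add: chain_space_def tensor_def free.quot_space_add free.quot_space_smult
      free.quot_space_carrier free.quot_space_zero free.subspace_span)

lemma chain_space_abelian_group: "abelian_group (C n)"
  unfolding chain_space_def tensor_def
  by (rule free.quot_space_abelian_group[OF subspace_free_on free.subspace_span])

lemmas chain_group_closed =
  abelian_monoid.a_closed[OF abelian_group.axioms(1)[OF chain_space_abelian_group]]
  abelian_group.a_inv_closed[OF chain_space_abelian_group]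
  abelian_group.minus_closed[OF chain_space_abelian_group]
  abelian_monoid.zero_closed[OF abelian_group.axioms(1)[OF chain_space_abelian_group]]

lemma chain_smult_closed: "u \<in> carrier (C n) \<Longrightarrow> c \<odot>\<^bsub>C n\<^esub> u \<in> carrier (C n)"
  by (auto simp: chain_space_simps intro!: imageI free.subspace_scale[OF subspace_free_on])

lemma gen_in_free_on: "a \<in> A \<Longrightarrow> gen a \<in> free_on A"
  by (auto simp: free_on_eq_span intro: free.span_base)

lemma wedge_eq: "length xs = n \<Longrightarrow> wedge scaleL xs = ext_class n (gen xs)"
  by (auto simp: wedge_def)

lemma wedge_in_carrier: "length xs = n \<Longrightarrow> wedge scaleL xs \<in> carrier (ext_power scaleL n)"
  by (auto simp: wedge_eq ext_power_simps intro!: imageI gen_in_free_on)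

lemma elem_eq: "length xs = n \<Longrightarrow> elem scaleL scaleM m xs = chain_class n (gen (m, wedge scaleL xs))"
  by (auto simp: elem_def tens_def)

lemma elem_closed: "length xs = n \<Longrightarrow> elem scaleL scaleM m xs \<in> carrier (C n)"
  by (auto simp: elem_eq chain_space_simps intro!: imageI gen_in_free_on wedge_in_carrier)

lemma chain_relsI:
  "v \<in> carrier (ext_power scaleL n) \<Longrightarrow>
    gen (m + m', v) - gen (m, v) - gen (m', v) \<in> chain_rels n"
  "v \<in> carrier (ext_power scaleL n) \<Longrightarrow>
    gen (scaleM c m, v) - fscale c (gen (m, v)) \<in> chain_rels n"
  "v \<in> carrier (ext_power scaleL n) \<Longrightarrow> v' \<in> carrier (ext_power scaleL n) \<Longrightarrow>
    gen (m, v \<oplus>\<^bsub>ext_power scaleL n\<^esub> v') - gen (m, v) - gen (m, v') \<in> chain_rels n"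
  "v \<in> carrier (ext_power scaleL n) \<Longrightarrow>
    gen (m, c \<odot>\<^bsub>ext_power scaleL n\<^esub> v) - fscale c (gen (m, v)) \<in> chain_rels n"
  unfolding tensor_rels_def by blast+

lemma chain_class_gen_add:
  assumes "p \<in> free_on {xs. length xs = n}" "q \<in> free_on {xs. length xs = n}"
  shows "chain_class n (gen (m, ext_class n (p + q))) =
    chain_class n (gen (m, ext_class n p)) \<oplus>\<^bsub>C n\<^esub> chain_class n (gen (m, ext_class n q))"
  using chain_relsI(3)[of "ext_class n p" n "ext_class n q" m] assms
  by (simp add: chain_space_simps(1) ext_class_eq_iff ext_power_simps free.span_base
      imageI diff_diff_eq)

lemma chain_class_gen_scale:
  assumes "p \<in> free_on {xs. length xs = n}"
  shows "chain_class n (gen (m, ext_class n (fscale c p))) =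
    c \<odot>\<^bsub>C n\<^esub> chain_class n (gen (m, ext_class n p))"
  using chain_relsI(4)[of "ext_class n p" n m c] assms
  by (simp add: chain_space_simps(2) ext_class_eq_iff ext_power_simps free.span_base imageI)

lemma chain_class_gen_zero: "chain_class n (gen (m, ext_class n 0)) = \<zero>\<^bsub>C n\<^esub>"
  using chain_class_gen_scale[of 0 n m 0]
  by (simp add: chain_space_simps free.subspace_0[OF subspace_free_on])

text \<open>The elementary tensors generate the chain space.\<close>

lemma chain_induct [consumes 1, case_names zero elem add smult]:
  assumes u: "u \<in> carrier (C n)"
    and zero: "P \<zero>\<^bsub>C n\<^esub>"
    and elem: "\<And>m xs. length xs = n \<Longrightarrow> P (elem scaleL scaleM m xs)"
    and add: "\<And>u v. \<lbrakk>u \<in> carrier (C n); v \<in> carrier (C n); P u; P v\<rbrakk> \<Longrightarrow> P (u \<oplus>\<^bsub>C n\<^esub> v)"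
    and smult: "\<And>c u. \<lbrakk>u \<in> carrier (C n); P u\<rbrakk> \<Longrightarrow> P (c \<odot>\<^bsub>C n\<^esub> u)"
  shows "P u"
proof -
  let ?U = "free_on {xs. length xs = n}"
  let ?V = "free_on (UNIV \<times> carrier (ext_power scaleL n))"
  have gen_V: "gen (m, ext_class n q) \<in> ?V" if "q \<in> ?U" for m q
    using that by (intro gen_in_free_on) (auto simp: ext_power_simps)
  have tens: "q \<in> ?U \<and> P (chain_class n (gen (m, ext_class n q)))"
    if "q \<in> free.span (gen ` {xs. length xs = n})" for q m
    using that
  proof (induction rule: free.span_induct_alt)
    case base
    show ?case by (simp add: chain_class_gen_zero zero free.subspace_0[OF subspace_free_on])
  next
    case (step c x y)
    then obtain xs where xs: "x = gen xs" "length xs = n" by auto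
    then have x: "x \<in> ?U" and cx: "fscale c x \<in> ?U"
      by (simp_all add: gen_in_free_on free.subspace_scale[OF subspace_free_on])
    have in_C: "chain_class n (gen (m, ext_class n q)) \<in> carrier (C n)" if "q \<in> ?U" for q
      using gen_V[OF that, of m] by (auto simp: chain_space_simps intro: imageI)
    have "P (chain_class n (gen (m, ext_class n x)))"
      using elem[OF xs(2), of m] by (simp add: elem_eq wedge_eq xs)
    then have "P (chain_class n (gen (m, ext_class n (fscale c x + y))))"
      using step cx in_C x
      by (simp add: chain_class_gen_add chain_class_gen_scale add smult chain_smult_closed)
    then show ?case using cx step free.subspace_add[OF subspace_free_on] by blast
  qed
  obtain p where p: "u = chain_class n p" "p \<in> ?V" using u by (auto simp: chain_space_simps)
  from p(2) have "p \<in> free.span (gen ` (UNIV \<times> carrier (ext_power scaleL n)))"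
    by (simp add: free_on_eq_span)
  then have "p \<in> ?V \<and> P (chain_class n p)"
  proof (induction rule: free.span_induct_alt)
    case base
    show ?case using zero by (simp add: chain_space_simps free.subspace_0[OF subspace_free_on])
  next
    case (step c x y)
    then obtain m q where q: "x = gen (m, ext_class n q)" "q \<in> ?U"
      by (auto simp: ext_power_simps)
    then have x: "x \<in> ?V" and cx: "fscale c x \<in> ?V"
      by (simp_all add: gen_V free.subspace_scale[OF subspace_free_on])
    have in_C: "chain_class n r \<in> carrier (C n)" if "r \<in> ?V" for r
      using that by (auto simp: chain_space_simps)
    have "P (chain_class n x)" using tens[of q m] q by (simp add: free_on_eq_span)
    then have "P (c \<odot>\<^bsub>C n\<^esub> chain_class n x \<oplus>\<^bsub>C n\<^esub> chain_class n y)"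
      using step x in_C by (intro add smult chain_smult_closed) auto
    moreover have "fscale c x + y \<in> ?V"
      using free.subspace_add[OF subspace_free_on cx] step by blast
    ultimately show ?case by (simp add: chain_space_simps(1,2))
  qed
  then show ?thesis using p by simp
qed

text \<open>A chosen representative of a coset.\<close>

definition rep :: "'a set \<Rightarrow> 'a"
  where "rep X = (SOME x. x \<in> X)"

lemma rep_coset: "free.subspace W \<Longrightarrow> rep (coset W p) - p \<in> W"
  using someI_ex[of "\<lambda>x. x \<in> coset W p"] free.coset_nonempty[of W p]
  by (simp add: rep_def free.in_coset_iff ex_in_conv[symmetric] del: ex_in_conv)

text \<open>For fixed \<open>m\<close>, the linear map on formal combinations of lists with
  \<open>[x\<^sub>1, \<dots>, x\<^sub>n] \<mapsto> m \<otimes> x\<^sub>1 \<and> \<dots> \<and> x\<^sub>n\<close>. It kills the relations of \<open>\<Lambda>\<^sup>n L\<close>.\<close>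

definition ext_eval :: "'m \<Rightarrow> ('l list \<Rightarrow>\<^sub>0 'k) \<Rightarrow> ('m \<times> 'l list \<Rightarrow>\<^sub>0 'k)"
  where "ext_eval m = free_lift (pure m)"

lemma flinear_ext_eval: "flinear (ext_eval m)"
  unfolding ext_eval_def by (rule flinear_free_lift)

lemmas ext_eval_simps = linear_simps[OF flinear_ext_eval]

lemma ext_eval_gen [simp]: "ext_eval m (gen xs) = pure m xs"
  by (simp add: ext_eval_def)

lemma ext_eval_left:
  "ext_eval (m + m') p = ext_eval m p + ext_eval m' p"
  "ext_eval (scaleM c m) p = fscale c (ext_eval m p)"
proof -
  show "ext_eval (m + m') p = ext_eval m p + ext_eval m' p"
    by (rule flinear_eqI[where F = "ext_eval (m + m')" and G = "\<lambda>p. ext_eval m p + ext_eval m' p"])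
      (rule flinear_intros flinear_ext_eval | simp add: pure_simps)+
  show "ext_eval (scaleM c m) p = fscale c (ext_eval m p)"
    by (rule flinear_eqI[where F = "ext_eval (scaleM c m)" and G = "\<lambda>p. fscale c (ext_eval m p)"])
      (rule flinear_intros flinear_ext_eval | simp add: pure_simps)+
qed

lemma linear_vanish_span:
  assumes "flinear F" "\<And>r. r \<in> S \<Longrightarrow> F r = 0" "p \<in> free.span S"
  shows "F p = 0"
  using assms(3)
  by (induction rule: free.span_induct_alt) (simp_all add: assms linear_simps[OF assms(1)])

lemma ext_eval_rels:
  assumes "r \<in> ext_rels scaleL n"
  shows "ext_eval m r = 0"
  using assms unfolding ext_rels_def
  by (auto simp: ext_eval_simps pure_simps pure_not_distinct)

lemma ext_eval_rep: "ext_eval m (rep (ext_class n p)) = ext_eval m p"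
proof -
  have "rep (ext_class n p) - p \<in> free.span (ext_rels scaleL n)"
    by (rule rep_coset[OF free.subspace_span])
  then have "ext_eval m (rep (ext_class n p) - p) = 0"
    by (rule linear_vanish_span[OF flinear_ext_eval, rotated]) (rule ext_eval_rels)
  then show ?thesis by (simp add: ext_eval_simps)
qed

text \<open>The linear map on formal combinations of pairs \<open>(m, X)\<close>, where \<open>X\<close> is a class in \<open>\<Lambda>\<^sup>n L\<close>, which
  evaluates a representative of \<open>X\<close>. It kills the relations of \<open>M \<otimes> \<Lambda>\<^sup>n L\<close>.\<close>

definition chain_eval ::
    "('m \<times> ('l list \<Rightarrow>\<^sub>0 'k) set \<Rightarrow>\<^sub>0 'k) \<Rightarrow> ('m \<times> 'l list \<Rightarrow>\<^sub>0 'k)"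
  where "chain_eval = free_lift (\<lambda>(m, X). ext_eval m (rep X))"

lemma flinear_chain_eval: "flinear chain_eval"
  unfolding chain_eval_def by (rule flinear_free_lift)

lemmas chain_eval_simps = linear_simps[OF flinear_chain_eval]

lemma chain_eval_gen: "chain_eval (gen (m, ext_class n p)) = ext_eval m p"
  by (simp add: chain_eval_def ext_eval_rep)

lemma chain_eval_rels:
  assumes "r \<in> chain_rels n"
  shows "chain_eval r = 0"
  using assms unfolding tensor_rels_def
  by (auto simp: ext_power_simps chain_eval_simps chain_eval_gen ext_eval_left ext_eval_simps)

text \<open>The homomorphism from the chain spaces to the free space; one definition serves all \<open>n\<close>.\<close>

definition emb :: "('k, 'l, 'm) chain \<Rightarrow> ('m \<times> 'l list \<Rightarrow>\<^sub>0 'k)"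
  where "emb u = chain_eval (rep u)"

lemma emb_chain_class: "emb (chain_class n p) = chain_eval p"
proof -
  have "rep (chain_class n p) - p \<in> free.span (chain_rels n)"
    by (rule rep_coset[OF free.subspace_span])
  then have "chain_eval (rep (chain_class n p) - p) = 0"
    by (rule linear_vanish_span[OF flinear_chain_eval, rotated]) (rule chain_eval_rels)
  then show ?thesis by (simp add: emb_def chain_eval_simps)
qed

lemma emb_elem: "emb (elem scaleL scaleM m xs) = pure m xs"
  by (simp add: elem_eq[OF refl] emb_chain_class wedge_eq[OF refl] chain_eval_gen)

lemma emb_add: "\<lbrakk>u \<in> carrier (C n); v \<in> carrier (C n)\<rbrakk> \<Longrightarrow> emb (u \<oplus>\<^bsub>C n\<^esub> v) = emb u + emb v"
  and emb_smult: "u \<in> carrier (C n) \<Longrightarrow> emb (c \<odot>\<^bsub>C n\<^esub> u) = fscale c (emb u)"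
  and emb_zero: "emb \<zero>\<^bsub>C n\<^esub> = 0"
  by (auto simp: chain_space_simps emb_chain_class chain_eval_simps)

text \<open>A map in the opposite direction, which gives the injectivity of \<open>emb\<close>: in a pair \<open>(m, xs)\<close>, a list
  \<open>xs\<close> of length \<open>n\<close> is replaced by its wedge product in \<open>\<Lambda>\<^sup>n L\<close>. Pairs with other lists go to \<open>0\<close>, so that the relations
  of all degrees are sent into those of degree \<open>n\<close>.\<close>

definition class_map :: "nat \<Rightarrow> ('m \<times> 'l list \<Rightarrow>\<^sub>0 'k) \<Rightarrow> ('m \<times> ('l list \<Rightarrow>\<^sub>0 'k) set \<Rightarrow>\<^sub>0 'k)"
  where "class_map n =
    free_lift (\<lambda>(m, xs). if length xs = n then gen (m, wedge scaleL xs) else 0)"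

lemma flinear_class_map: "flinear (class_map n)"
  unfolding class_map_def by (rule flinear_free_lift)

lemmas class_map_simps = linear_simps[OF flinear_class_map]

lemma class_map_gen:
  "class_map n (gen (m, xs)) = (if length xs = n then gen (m, ext_class n (gen xs)) else 0)"
  by (simp add: class_map_def wedge_eq)

lemma ext_class_relsI:
  assumes "length us + length vs + 1 = n"
  shows "ext_class n (gen (us @ (x + y) # vs)) = ext_class n (gen (us @ x # vs) + gen (us @ y # vs))"
    and "ext_class n (gen (us @ scaleL c x # vs)) = ext_class n (fscale c (gen (us @ x # vs)))"
proof -
  have "gen (us @ (x + y) # vs) - gen (us @ x # vs) - gen (us @ y # vs) \<in> ext_rels scaleL n"
    and "gen (us @ scaleL c x # vs) - fscale c (gen (us @ x # vs)) \<in> ext_rels scaleL n"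
    unfolding ext_rels_def using assms by blast+
  then show "ext_class n (gen (us @ (x + y) # vs)) = ext_class n (gen (us @ x # vs) + gen (us @ y # vs))"
    and "ext_class n (gen (us @ scaleL c x # vs)) = ext_class n (fscale c (gen (us @ x # vs)))"
    by (simp_all add: ext_class_eq_iff free.span_base diff_diff_eq)
qed

lemma ext_class_not_distinct:
  assumes "length xs = n" "\<not> distinct xs"
  shows "ext_class n (gen xs) = ext_class n 0"
proof -
  have "gen xs \<in> ext_rels scaleL n"
    unfolding ext_rels_def using assms by blast
  then show ?thesis by (simp add: ext_class_eq_iff free.span_base)
qed

lemma class_map_rels:
  assumes "r \<in> rels"
  shows "class_map n r \<in> free.span (chain_rels n)"
proof -
  have fo: "gen xs \<in> free_on {xs. length xs = n}" if "length xs = n" for xs :: "'l list"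
    using that by (simp add: gen_in_free_on)
  have w: "ext_class n (gen xs) \<in> carrier (ext_power scaleL n)" if "length xs = n" for xs
    using fo[OF that] by (auto simp: ext_power_simps intro!: imageI)
  have zero: "0 \<in> free.span (chain_rels n)" by (rule free.span_zero)
  have linM: "gen (m + m', ext_class n (gen xs)) - gen (m, ext_class n (gen xs))
      - gen (m', ext_class n (gen xs)) \<in> free.span (chain_rels n)"
    "gen (scaleM c m, ext_class n (gen xs)) - fscale c (gen (m, ext_class n (gen xs)))
      \<in> free.span (chain_rels n)"
    if "length xs = n" for m m' c xs
    using w[OF that] by (auto intro: free.span_base chain_relsI)
  have add: "gen (m, ext_class n (gen (us @ (x + y) # vs))) - gen (m, ext_class n (gen (us @ x # vs)))
      - gen (m, ext_class n (gen (us @ y # vs))) \<in> free.span (chain_rels n)"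
    if "Suc (length us + length vs) = n" for m us x y vs
    using chain_class_gen_add[OF fo[of "us @ x # vs"] fo[of "us @ y # vs"], of m] that
    by (simp add: ext_class_relsI chain_space_simps ext_class_eq_iff diff_diff_eq)
  have scale: "gen (m, ext_class n (gen (us @ scaleL c x # vs)))
      - fscale c (gen (m, ext_class n (gen (us @ x # vs)))) \<in> free.span (chain_rels n)"
    if "Suc (length us + length vs) = n" for m us c x vs
    using chain_class_gen_scale[OF fo[of "us @ x # vs"], of m c] that
    by (simp add: ext_class_relsI chain_space_simps ext_class_eq_iff)
  have nd: "gen (m, ext_class n (gen xs)) \<in> free.span (chain_rels n)"
    if "length xs = n" "\<not> distinct xs" for m xs
    using chain_class_gen_zero[of n m] that
    by (simp add: ext_class_not_distinct chain_space_simps ext_class_eq_iff)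
  show ?thesis
    using assms unfolding rels_def
    by (auto simp: class_map_simps class_map_gen zero linM add scale nd)
qed

lemma emb_inj:
  assumes "u \<in> carrier (C n)" "v \<in> carrier (C n)" "emb u = emb v"
  shows "u = v"
proof -
  \<comment> \<open>Each chain is the image of some \<open>t\<close>; if \<open>emb\<close> does not separate two chains, the difference
    of the corresponding \<open>t\<close> lies in the span of the relations, and so the chains agree.\<close>
  have lift: "\<exists>t. u = chain_class n (class_map n t) \<and> emb u = proj t" if "u \<in> carrier (C n)" for u
    using that
  proof (induction rule: chain_induct)
    case zero
    show ?case
      by (rule exI[of _ 0]) (simp add: chain_space_simps emb_chain_class class_map_simps
          chain_eval_simps proj_simps)
  next
    case (elem m xs)
    then have "elem scaleL scaleM m xs = chain_class n (class_map n (gen (m, xs)))"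
      by (simp add: elem_eq wedge_eq class_map_gen)
    moreover have "emb (elem scaleL scaleM m xs) = proj (gen (m, xs))"
      by (simp add: emb_elem pure_def)
    ultimately show ?case by blast
  next
    case (add u v)
    then obtain s t where s: "u = chain_class n (class_map n s)" "emb u = proj s"
      and t: "v = chain_class n (class_map n t)" "emb v = proj t" by blast
    have "u \<oplus>\<^bsub>C n\<^esub> v = chain_class n (class_map n (s + t))"
      by (simp add: s(1) t(1) chain_space_simps(1) class_map_simps)
    moreover have "emb (u \<oplus>\<^bsub>C n\<^esub> v) = proj (s + t)"
      by (simp add: emb_add[OF add(1,2)] s(2) t(2) proj_simps)
    ultimately show ?case by blast
  next
    case (smult c u)
    then obtain t where t: "u = chain_class n (class_map n t)" "emb u = proj t" by blast
    have "c \<odot>\<^bsub>C n\<^esub> u = chain_class n (class_map n (fscale c t))"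
      by (simp add: t(1) chain_space_simps(2) class_map_simps)
    moreover have "emb (c \<odot>\<^bsub>C n\<^esub> u) = proj (fscale c t)"
      by (simp add: emb_smult[OF smult(1)] t(2) proj_simps)
    ultimately show ?case by blast
  qed
  obtain s t where s: "u = chain_class n (class_map n s)" "emb u = proj s"
    and t: "v = chain_class n (class_map n t)" "emb v = proj t"
    using lift assms by meson
  have "s - t \<in> free.span rels"
    using s t assms by (simp add: proj_eq_0_iff[symmetric] proj_simps)
  then have "class_map n (s - t) \<in> free.span (chain_rels n)"
  proof (induction rule: free.span_induct_alt)
    case base
    show ?case by (simp add: class_map_simps free.span_zero)
  next
    case (step c x y)
    then show ?case
      by (simp add: class_map_simps free.span_add free.span_scale class_map_rels)
  qed
  then show ?thesis by (simp add: s t ext_class_eq_iff class_map_simps)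
qed

lemma emb_uminus:
  assumes "u \<in> carrier (C n)"
  shows "emb (\<ominus>\<^bsub>C n\<^esub> u) = - emb u"
proof -
  interpret abelian_group "C n" by (rule chain_space_abelian_group)
  have "emb (\<ominus>\<^bsub>C n\<^esub> u \<oplus>\<^bsub>C n\<^esub> u) = 0" using assms by (simp add: l_neg emb_zero)
  then show ?thesis using assms by (simp add: emb_add eq_neg_iff_add_eq_0)
qed

lemma emb_minus:
  assumes "u \<in> carrier (C n)" "v \<in> carrier (C n)"
  shows "emb (u \<ominus>\<^bsub>C n\<^esub> v) = emb u - emb v"
proof -
  interpret abelian_group "C n" by (rule chain_space_abelian_group)
  show ?thesis using assms by (simp add: a_minus_def emb_add emb_uminus)
qed

lemma emb_finsum:
  assumes "finite I" "\<And>i. i \<in> I \<Longrightarrow> f i \<in> carrier (C n)"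
  shows "emb (\<Oplus>\<^bsub>C n\<^esub>i\<in>I. f i) = (\<Sum>i\<in>I. emb (f i))"
proof -
  interpret abelian_group "C n" by (rule chain_space_abelian_group)
  show ?thesis
    using assms by (induction I) (simp_all add: emb_zero emb_add finsum_closed Pi_iff)
qed

text \<open>If the prescribed values correspond under \<open>emb\<close> to those of a linear map \<open>F\<close> of the free
  space, the map with these values exists, and \<open>emb\<close> intertwines it with \<open>F\<close>. It is
  \<open>emb\<close> followed by \<open>F\<close> and by the inverse of \<open>emb\<close>; the values of \<open>F\<close> at the images of chains
  of degree \<open>n\<close> are images of chains of degree \<open>k\<close> because this is so for elementary tensors.\<close>

lemma lin_ext_emb:
  assumes F: "flinear F"
    and g: "\<And>m xs. length xs = n \<Longrightarrow> g m xs \<in> carrier (C k)"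
    and g_emb: "\<And>m xs. length xs = n \<Longrightarrow> emb (g m xs) = F (pure m xs)"
    and u: "u \<in> carrier (C n)"
  shows "lin_ext scaleL scaleM n (C k) g u \<in> carrier (C k)"
    and "emb (lin_ext scaleL scaleM n (C k) g u) = F (emb u)"
proof -
  interpret n: abelian_group "C n" by (rule chain_space_abelian_group)
  interpret k: abelian_group "C k" by (rule chain_space_abelian_group)
  have ex: "\<exists>v\<in>carrier (C k). emb v = F (emb u)" if "u \<in> carrier (C n)" for u
    using that
  proof (induction rule: chain_induct)
    case zero
    show ?case by (rule bexI[of _ "\<zero>\<^bsub>C k\<^esub>"]) (simp_all add: emb_zero linear_simps[OF F])
  next
    case (elem m xs)
    then show ?case by (intro bexI[of _ "g m xs"]) (simp_all add: g g_emb emb_elem)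
  next
    case (add u v)
    then obtain u' v' where "u' \<in> carrier (C k)" "emb u' = F (emb u)"
      "v' \<in> carrier (C k)" "emb v' = F (emb v)" by blast
    then show ?case using add(1,2)
      by (intro bexI[of _ "u' \<oplus>\<^bsub>C k\<^esub> v'"]) (simp_all add: emb_add linear_simps[OF F])
  next
    case (smult c u)
    then obtain u' where "u' \<in> carrier (C k)" "emb u' = F (emb u)" by blast
    then show ?case using smult(1)
      by (intro bexI[of _ "c \<odot>\<^bsub>C k\<^esub> u'"])
        (simp_all add: emb_smult linear_simps[OF F] chain_smult_closed)
  qed
  define F' where "F' = (\<lambda>u\<in>carrier (C n). SOME v. v \<in> carrier (C k) \<and> emb v = F (emb u))"
  have F': "F' u \<in> carrier (C k)" "emb (F' u) = F (emb u)" if "u \<in> carrier (C n)" for u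
    using someI_ex[of "\<lambda>v. v \<in> carrier (C k) \<and> emb v = F (emb u)"] ex[OF that] that
    by (auto simp: F'_def)
  have "lin_ext scaleL scaleM n (C k) g = F'"
    unfolding lin_ext_def
  proof (rule the_equality)
    have "F' (u \<oplus>\<^bsub>C n\<^esub> v) = F' u \<oplus>\<^bsub>C k\<^esub> F' v" if "u \<in> carrier (C n)" "v \<in> carrier (C n)" for u v
      using that by (intro emb_inj[of _ k]) (simp_all add: F' emb_add linear_simps[OF F])
    moreover have "F' (c \<odot>\<^bsub>C n\<^esub> u) = c \<odot>\<^bsub>C k\<^esub> F' u" if "u \<in> carrier (C n)" for c u
      using that
      by (intro emb_inj[of _ k]) (simp_all add: F' emb_smult linear_simps[OF F] chain_smult_closed)
    moreover have "F' (elem scaleL scaleM m xs) = g m xs" if "length xs = n" for m xs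
      using that by (intro emb_inj[of _ k]) (simp_all add: F' elem_closed g g_emb emb_elem)
    moreover have "F' \<in> carrier (C n) \<rightarrow>\<^sub>E carrier (C k)"
      using F'(1) by (auto simp: F'_def)
    ultimately show "F' \<in> lin_maps (C n) (C k) \<and>
        (\<forall>m xs. length xs = n \<longrightarrow> F' (elem scaleL scaleM m xs) = g m xs)"
      by (simp add: lin_maps_def)
  next
    fix G assume "G \<in> lin_maps (C n) (C k) \<and>
        (\<forall>m xs. length xs = n \<longrightarrow> G (elem scaleL scaleM m xs) = g m xs)"
    then have G_ext: "G \<in> carrier (C n) \<rightarrow>\<^sub>E carrier (C k)"
      and G_add: "\<And>u v. \<lbrakk>u \<in> carrier (C n); v \<in> carrier (C n)\<rbrakk> \<Longrightarrow> G (u \<oplus>\<^bsub>C n\<^esub> v) = G u \<oplus>\<^bsub>C k\<^esub> G v"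
      and G_smult: "\<And>c u. u \<in> carrier (C n) \<Longrightarrow> G (c \<odot>\<^bsub>C n\<^esub> u) = c \<odot>\<^bsub>C k\<^esub> G u"
      and G_elem: "\<And>m xs. length xs = n \<Longrightarrow> G (elem scaleL scaleM m xs) = g m xs"
      by (auto simp: lin_maps_def)
    have G: "G u \<in> carrier (C k)" if "u \<in> carrier (C n)" for u
      using G_ext that by (rule PiE_mem)
    have "emb (G u) = F (emb u)" if "u \<in> carrier (C n)" for u
      using that
    proof (induction rule: chain_induct)
      case zero
      have "emb (G \<zero>\<^bsub>C n\<^esub>) = emb (G \<zero>\<^bsub>C n\<^esub>) + emb (G \<zero>\<^bsub>C n\<^esub>)"
        using G_add[of "\<zero>\<^bsub>C n\<^esub>" "\<zero>\<^bsub>C n\<^esub>"] emb_add[OF G G, of "\<zero>\<^bsub>C n\<^esub>" "\<zero>\<^bsub>C n\<^esub>"] by simp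
      then show ?case by (simp add: emb_zero linear_simps[OF F])
    qed (simp_all add: G_elem g_emb emb_elem G_add G_smult emb_add emb_smult G linear_simps[OF F])
    then have "G u = F' u" if "u \<in> carrier (C n)" for u
      using that by (intro emb_inj[of _ k]) (simp_all add: G F')
    then show "G = F'"
      using G_ext by (intro ext) (auto simp: F'_def PiE_def extensional_def)
  qed
  then show "lin_ext scaleL scaleM n (C k) g u \<in> carrier (C k)"
    and "emb (lin_ext scaleL scaleM n (C k) g u) = F (emb u)"
    using F' u by simp_all
qed

end

section \<open>Transfer of the formulas to the chain spaces\<close>

context hom_chains
begin

lemma length_nths_omit:
  assumes "i < length xs"
  shows "length (nths xs (- {i})) = length xs - 1"
proof -
  have "{k. k < length xs \<and> k \<in> - {i}} = {..<length xs} - {i}" by auto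
  then show ?thesis using assms by (simp add: length_nths)
qed

lemma length_nths_omit2:
  assumes "i < j" "j < length xs"
  shows "Suc (length (nths xs (- {i, j}))) = length xs - 1"
proof -
  have "{k. k < length xs \<and> k \<in> - {i, j}} = {..<length xs} - {i, j}" by auto
  then show ?thesis using assms by (simp add: length_nths)
qed

text \<open>In degree \<open>0\<close> the sums are empty and \<open>n - 1 = 0\<close>, so the statement holds for \<open>n = 0\<close>
  too.\<close>

lemma diff_emb:
  assumes u: "u \<in> carrier (C n)" and k: "k = n - 1"
  shows "diff scaleL br \<alpha>L scaleM act \<alpha>M n u \<in> carrier (C k)"
    and "emb (diff scaleL br \<alpha>L scaleM act \<alpha>M n u) = bd (emb u)"
proof -
  interpret abelian_group "C k" by (rule chain_space_abelian_group)
  define s where "s m xs i = (-1) ^ i \<odot>\<^bsub>C k\<^esub>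
    elem scaleL scaleM (act m (xs ! i)) (nths (map \<alpha>L xs) (- {i}))" for m xs i
  define t where "t m xs j i = (-1) ^ (i + j) \<odot>\<^bsub>C k\<^esub>
    elem scaleL scaleM (\<alpha>M m) (br (xs ! i) (xs ! j) # nths (map \<alpha>L xs) (- {i, j}))" for m xs j i
  let ?g = "\<lambda>m xs. (\<Oplus>\<^bsub>C k\<^esub>i\<in>{..<n}. s m xs i) \<oplus>\<^bsub>C k\<^esub>
    (\<Oplus>\<^bsub>C k\<^esub>j\<in>{..<n}. \<Oplus>\<^bsub>C k\<^esub>i\<in>{..<j}. t m xs j i)"
  have diff_eq: "diff scaleL br \<alpha>L scaleM act \<alpha>M n = lin_ext scaleL scaleM n (C k) ?g"
    unfolding diff_def Let_def s_def t_def k ..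
  have s: "s m xs i \<in> carrier (C k)"
    "emb (s m xs i) = fscale ((-1) ^ i) (pure (act m (xs ! i)) (nths (map \<alpha>L xs) (- {i})))"
    if "length xs = n" "i < n" for m xs i
  proof -
    have "length (nths (map \<alpha>L xs) (- {i})) = k"
      using length_nths_omit[of i "map \<alpha>L xs"] that k by simp
    then have e: "elem scaleL scaleM (act m (xs ! i)) (nths (map \<alpha>L xs) (- {i})) \<in> carrier (C k)"
      by (rule elem_closed)
    show "s m xs i \<in> carrier (C k)"
      unfolding s_def by (rule chain_smult_closed[OF e])
    show "emb (s m xs i) = fscale ((-1) ^ i) (pure (act m (xs ! i)) (nths (map \<alpha>L xs) (- {i})))"
      unfolding s_def emb_smult[OF e] emb_elem ..
  qed
  have t: "t m xs j i \<in> carrier (C k)"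
    "emb (t m xs j i) = fscale ((-1) ^ (i + j))
      (pure (\<alpha>M m) (br (xs ! i) (xs ! j) # nths (map \<alpha>L xs) (- {i, j})))"
    if "length xs = n" "i < j" "j < n" for m xs i j
  proof -
    have "length (br (xs ! i) (xs ! j) # nths (map \<alpha>L xs) (- {i, j})) = k"
      using length_nths_omit2[of i j "map \<alpha>L xs"] that k by simp
    then have e: "elem scaleL scaleM (\<alpha>M m) (br (xs ! i) (xs ! j) # nths (map \<alpha>L xs) (- {i, j}))
        \<in> carrier (C k)"
      by (rule elem_closed)
    show "t m xs j i \<in> carrier (C k)"
      unfolding t_def by (rule chain_smult_closed[OF e])
    show "emb (t m xs j i) = fscale ((-1) ^ (i + j))
        (pure (\<alpha>M m) (br (xs ! i) (xs ! j) # nths (map \<alpha>L xs) (- {i, j})))"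
      unfolding t_def emb_smult[OF e] emb_elem ..
  qed
  have s_sum: "(\<Oplus>\<^bsub>C k\<^esub>i\<in>{..<n}. s m xs i) \<in> carrier (C k)"
    and t_row: "j < n \<Longrightarrow> (\<Oplus>\<^bsub>C k\<^esub>i\<in>{..<j}. t m xs j i) \<in> carrier (C k)"
    if "length xs = n" for m xs j
    by (rule finsum_closed; use s(1) t(1) that in blast)+
  have t_sum: "(\<Oplus>\<^bsub>C k\<^esub>j\<in>{..<n}. \<Oplus>\<^bsub>C k\<^esub>i\<in>{..<j}. t m xs j i) \<in> carrier (C k)"
    if "length xs = n" for m xs
    by (rule finsum_closed) (use t_row that in blast)
  have g: "?g m xs \<in> carrier (C k)" if "length xs = n" for m xs
    by (rule a_closed[OF s_sum[OF that] t_sum[OF that]])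
  have g_emb: "emb (?g m xs) = bd (pure m xs)" if xs: "length xs = n" for m xs
  proof -
    have "emb (\<Oplus>\<^bsub>C k\<^esub>i\<in>{..<n}. s m xs i) = (\<Sum>i<n. emb (s m xs i))"
      by (rule emb_finsum) (use s(1)[OF xs] in auto)
    moreover have "emb (\<Oplus>\<^bsub>C k\<^esub>j\<in>{..<n}. \<Oplus>\<^bsub>C k\<^esub>i\<in>{..<j}. t m xs j i) =
        (\<Sum>j<n. emb (\<Oplus>\<^bsub>C k\<^esub>i\<in>{..<j}. t m xs j i))"
      by (rule emb_finsum) (use t_row[OF xs] in auto)
    moreover have "emb (\<Oplus>\<^bsub>C k\<^esub>i\<in>{..<j}. t m xs j i) = (\<Sum>i<j. emb (t m xs j i))" if "j < n" for j
      by (rule emb_finsum) (use t(1)[OF xs] that in auto)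
    ultimately show ?thesis
      by (simp add: bd_pure bd_fun_def emb_add[OF s_sum[OF xs] t_sum[OF xs]] s[OF xs] t[OF xs] xs)
  qed
  show "diff scaleL br \<alpha>L scaleM act \<alpha>M n u \<in> carrier (C k)"
    and "emb (diff scaleL br \<alpha>L scaleM act \<alpha>M n u) = bd (emb u)"
    unfolding diff_eq by (rule lin_ext_emb[OF flinear_bd g g_emb u]; assumption)+
qed

lemma theta_emb:
  assumes u: "u \<in> carrier (C n)"
  shows "theta scaleL br \<alpha>L scaleM act \<alpha>M n y u \<in> carrier (C n)"
    and "emb (theta scaleL br \<alpha>L scaleM act \<alpha>M n y u) = lie y (emb u)"
proof -
  interpret abelian_group "C n" by (rule chain_space_abelian_group)
  define s where "s m xs i = (-1) ^ (i + 1) \<odot>\<^bsub>C n\<^esub>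
    elem scaleL scaleM (\<alpha>M m) (br (xs ! i) y # nths (map \<alpha>L xs) (- {i}))" for m xs i
  let ?e = "\<lambda>m xs. elem scaleL scaleM (act m y) (map \<alpha>L xs)"
  let ?g = "\<lambda>m xs. (\<ominus>\<^bsub>C n\<^esub> ?e m xs) \<oplus>\<^bsub>C n\<^esub> (\<Oplus>\<^bsub>C n\<^esub>i\<in>{..<n}. s m xs i)"
  have theta_eq: "theta scaleL br \<alpha>L scaleM act \<alpha>M n y = lin_ext scaleL scaleM n (C n) ?g"
    unfolding theta_def Let_def s_def ..
  have s: "s m xs i \<in> carrier (C n)"
    "emb (s m xs i) = fscale ((-1) ^ (i + 1))
      (pure (\<alpha>M m) (br (xs ! i) y # nths (map \<alpha>L xs) (- {i})))"
    if "length xs = n" "i < n" for m xs i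
  proof -
    have "length (br (xs ! i) y # nths (map \<alpha>L xs) (- {i})) = n"
      using length_nths_omit[of i "map \<alpha>L xs"] that by simp
    then have e: "elem scaleL scaleM (\<alpha>M m) (br (xs ! i) y # nths (map \<alpha>L xs) (- {i})) \<in> carrier (C n)"
      by (rule elem_closed)
    show "s m xs i \<in> carrier (C n)"
      unfolding s_def by (rule chain_smult_closed[OF e])
    show "emb (s m xs i) = fscale ((-1) ^ (i + 1))
        (pure (\<alpha>M m) (br (xs ! i) y # nths (map \<alpha>L xs) (- {i})))"
      unfolding s_def emb_smult[OF e] emb_elem ..
  qed
  have s_sum: "(\<Oplus>\<^bsub>C n\<^esub>i\<in>{..<n}. s m xs i) \<in> carrier (C n)" if "length xs = n" for m xs
    by (rule finsum_closed) (use s(1) that in blast)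
  have e: "?e m xs \<in> carrier (C n)" if "length xs = n" for m xs
    by (rule elem_closed) (simp add: that)
  have g: "?g m xs \<in> carrier (C n)" if "length xs = n" for m xs
    by (rule a_closed[OF a_inv_closed[OF e[OF that]] s_sum[OF that]])
  have g_emb: "emb (?g m xs) = lie y (pure m xs)" if xs: "length xs = n" for m xs
  proof -
    have "emb (\<Oplus>\<^bsub>C n\<^esub>i\<in>{..<n}. s m xs i) = (\<Sum>i<n. emb (s m xs i))"
      by (rule emb_finsum) (use s(1)[OF xs] in auto)
    then show ?thesis
      by (simp add: lie_pure lie_fun_def emb_add[OF a_inv_closed[OF e[OF xs]] s_sum[OF xs]]
          emb_uminus[OF e[OF xs]] emb_elem s[OF xs] xs)
  qed
  show "theta scaleL br \<alpha>L scaleM act \<alpha>M n y u \<in> carrier (C n)"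
    and "emb (theta scaleL br \<alpha>L scaleM act \<alpha>M n y u) = lie y (emb u)"
    unfolding theta_eq by (rule lin_ext_emb[OF flinear_lie g g_emb u]; assumption)+
qed

lemma twist_emb:
  assumes u: "u \<in> carrier (C n)"
  shows "twist scaleL \<alpha>L scaleM \<alpha>M n u \<in> carrier (C n)"
    and "emb (twist scaleL \<alpha>L scaleM \<alpha>M n u) = tw (emb u)"
  unfolding twist_def
  by (rule lin_ext_emb[OF flinear_tw _ _ u]; simp add: elem_closed emb_elem)+

text \<open>The sign \<open>(-1)\<^sup>n\<close> is that of the cyclic permutation which moves the last factor to the
  front.\<close>

lemma insertion_emb:
  assumes u: "u \<in> carrier (C n)" and k: "k = n + 1"
  shows "insertion scaleL scaleM n y u \<in> carrier (C k)"
    and "emb (insertion scaleL scaleM n y u) = ins y (emb u)"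
proof -
  let ?g = "\<lambda>m xs. (-1) ^ n \<odot>\<^bsub>C k\<^esub> elem scaleL scaleM m (xs @ [y])"
  have insertion_eq: "insertion scaleL scaleM n y = lin_ext scaleL scaleM n (C k) ?g"
    unfolding insertion_def Let_def k ..
  have e: "elem scaleL scaleM m (xs @ [y]) \<in> carrier (C k)" if "length xs = n" for m xs
    by (rule elem_closed) (simp add: that k)
  have g: "?g m xs \<in> carrier (C k)" if "length xs = n" for m xs
    by (rule chain_smult_closed[OF e[OF that]])
  have g_emb: "emb (?g m xs) = ins y (pure m xs)" if "length xs = n" for m xs
  proof -
    have "emb (?g m xs) = fscale ((-1) ^ n) (fscale ((-1) ^ n) (pure m (y # xs)))"
      using pure_rotate[of m "[]" xs y] that by (simp add: emb_smult[OF e[OF that]] emb_elem)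
    also have "\<dots> = pure m (y # xs)"
      by (simp flip: power_mult_distrib)
    finally show ?thesis by simp
  qed
  show "insertion scaleL scaleM n y u \<in> carrier (C k)"
    and "emb (insertion scaleL scaleM n y u) = ins y (emb u)"
    unfolding insertion_eq by (rule lin_ext_emb[OF flinear_ins g g_emb u]; assumption)+
qed

end

theorem proposition3p1:
  fixes scaleL :: "'k::field \<Rightarrow> 'l::ab_group_add \<Rightarrow> 'l"
    and br :: "'l \<Rightarrow> 'l \<Rightarrow> 'l"
    and \<alpha>L :: "'l \<Rightarrow> 'l"
    and scaleM :: "'k \<Rightarrow> 'm::ab_group_add \<Rightarrow> 'm"
    and act :: "'m \<Rightarrow> 'l \<Rightarrow> 'm"
    and \<alpha>M :: "'m \<Rightarrow> 'm"
    and x y :: 'l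
  assumes "CHAR('k) \<noteq> 2"
    and "hom_lie_algebra scaleL br \<alpha>L"
    and "right_hom_module scaleL br \<alpha>L scaleM act \<alpha>M"
  shows
    "let C = chain_space scaleL scaleM;
         d = diff scaleL br \<alpha>L scaleM act \<alpha>M;
         \<theta> = theta scaleL br \<alpha>L scaleM act \<alpha>M;
         \<iota> = insertion scaleL scaleM;
         A = twist scaleL \<alpha>L scaleM \<alpha>M
     in
       (\<forall>n\<ge>1. \<forall>u\<in>carrier (C n).
          d (n + 1) (\<iota> n y u) \<oplus>\<^bsub>C n\<^esub> \<iota> (n - 1) (\<alpha>L y) (d n u) = \<ominus>\<^bsub>C n\<^esub> \<theta> n y u) \<and>
       (\<forall>n. \<forall>u\<in>carrier (C n).
          \<theta> n (\<alpha>L x) (\<theta> n y u) \<ominus>\<^bsub>C n\<^esub> \<theta> n (\<alpha>L y) (\<theta> n x u) = \<theta> n (br x y) (A n u)) \<and>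
       (\<forall>n\<ge>1. \<forall>u\<in>carrier (C (n - 1)).
          \<theta> n x (\<iota> (n - 1) y u) \<ominus>\<^bsub>C n\<^esub> \<iota> (n - 1) (\<alpha>L y) (\<theta> (n - 1) x u) =
            \<iota> (n - 1) (br x y) (A (n - 1) u)) \<and>
       (\<forall>n\<ge>1. \<forall>u\<in>carrier (C n).
          \<theta> (n - 1) (\<alpha>L y) (d n u) = d n (\<theta> n y u)) \<and>
       (\<forall>n\<ge>1. \<forall>u\<in>carrier (C (n + 1)).
          d n (d (n + 1) u) = \<zero>\<^bsub>C (n - 1)\<^esub>)"
proof -
  interpret hom_chains scaleL br \<alpha>L scaleM act \<alpha>M
    using assms by (simp add: hom_chains_def hom_chains_axioms_def)
  let ?d = "diff scaleL br \<alpha>L scaleM act \<alpha>M"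
  let ?\<theta> = "theta scaleL br \<alpha>L scaleM act \<alpha>M"
  let ?\<iota> = "insertion scaleL scaleM"
  let ?A = "twist scaleL \<alpha>L scaleM \<alpha>M"
  have a: "?d (n + 1) (?\<iota> n y u) \<oplus>\<^bsub>C n\<^esub> ?\<iota> (n - 1) (\<alpha>L y) (?d n u) = \<ominus>\<^bsub>C n\<^esub> ?\<theta> n y u"
    if n: "n \<ge> 1" and u: "u \<in> carrier (C n)" for n u
  proof (rule emb_inj)
    have du: "?d n u \<in> carrier (C (n - 1))" and \<iota>u: "?\<iota> n y u \<in> carrier (C (n + 1))"
      using diff_emb(1)[OF u] insertion_emb(1)[OF u] by blast+
    have d\<iota>: "?d (n + 1) (?\<iota> n y u) \<in> carrier (C n)" by (rule diff_emb(1)[OF \<iota>u]) simp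
    have \<iota>d: "?\<iota> (n - 1) (\<alpha>L y) (?d n u) \<in> carrier (C n)"
      by (rule insertion_emb(1)[OF du]) (use n in simp)
    show "?d (n + 1) (?\<iota> n y u) \<oplus>\<^bsub>C n\<^esub> ?\<iota> (n - 1) (\<alpha>L y) (?d n u) \<in> carrier (C n)"
      by (rule chain_group_closed(1)[OF d\<iota> \<iota>d])
    show "\<ominus>\<^bsub>C n\<^esub> ?\<theta> n y u \<in> carrier (C n)"
      by (rule chain_group_closed(2)[OF theta_emb(1)[OF u]])
    show "emb (?d (n + 1) (?\<iota> n y u) \<oplus>\<^bsub>C n\<^esub> ?\<iota> (n - 1) (\<alpha>L y) (?d n u)) = emb (\<ominus>\<^bsub>C n\<^esub> ?\<theta> n y u)"
      unfolding emb_add[OF d\<iota> \<iota>d] emb_uminus[OF theta_emb(1)[OF u]] theta_emb(2)[OF u]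
        diff_emb(2)[OF \<iota>u refl] insertion_emb(2)[OF du refl] diff_emb(2)[OF u refl]
        insertion_emb(2)[OF u refl] bd_ins
      by simp
  qed
  have b: "?\<theta> n (\<alpha>L x) (?\<theta> n y u) \<ominus>\<^bsub>C n\<^esub> ?\<theta> n (\<alpha>L y) (?\<theta> n x u) = ?\<theta> n (br x y) (?A n u)"
    if u: "u \<in> carrier (C n)" for n u
  proof (rule emb_inj)
    note \<theta> = theta_emb[OF theta_emb(1)[OF u]]
    show "?\<theta> n (\<alpha>L x) (?\<theta> n y u) \<ominus>\<^bsub>C n\<^esub> ?\<theta> n (\<alpha>L y) (?\<theta> n x u) \<in> carrier (C n)"
      by (rule chain_group_closed(3)[OF \<theta>(1) \<theta>(1)])
    show "?\<theta> n (br x y) (?A n u) \<in> carrier (C n)"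
      by (rule theta_emb(1)[OF twist_emb(1)[OF u]])
    show "emb (?\<theta> n (\<alpha>L x) (?\<theta> n y u) \<ominus>\<^bsub>C n\<^esub> ?\<theta> n (\<alpha>L y) (?\<theta> n x u)) =
        emb (?\<theta> n (br x y) (?A n u))"
      by (simp add: emb_minus[OF \<theta>(1) \<theta>(1)] \<theta>(2) theta_emb(2)[OF u]
          theta_emb(2)[OF twist_emb(1)[OF u]] twist_emb(2)[OF u] lie_lie)
  qed
  have c: "?\<theta> n x (?\<iota> (n - 1) y u) \<ominus>\<^bsub>C n\<^esub> ?\<iota> (n - 1) (\<alpha>L y) (?\<theta> (n - 1) x u) =
      ?\<iota> (n - 1) (br x y) (?A (n - 1) u)"
    if n: "n \<ge> 1" and u: "u \<in> carrier (C (n - 1))" for n u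
  proof (rule emb_inj)
    have n': "n = n - 1 + 1" using n by simp
    note \<iota> = insertion_emb[OF _ n']
    note \<theta>\<iota> = theta_emb[OF \<iota>(1)[OF u]] and \<iota>\<theta> = \<iota>[OF theta_emb(1)[OF u]]
    show "?\<theta> n x (?\<iota> (n - 1) y u) \<ominus>\<^bsub>C n\<^esub> ?\<iota> (n - 1) (\<alpha>L y) (?\<theta> (n - 1) x u) \<in> carrier (C n)"
      by (rule chain_group_closed(3)[OF \<theta>\<iota>(1) \<iota>\<theta>(1)])
    show "?\<iota> (n - 1) (br x y) (?A (n - 1) u) \<in> carrier (C n)"
      by (rule \<iota>(1)[OF twist_emb(1)[OF u]])
    show "emb (?\<theta> n x (?\<iota> (n - 1) y u) \<ominus>\<^bsub>C n\<^esub> ?\<iota> (n - 1) (\<alpha>L y) (?\<theta> (n - 1) x u)) =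
        emb (?\<iota> (n - 1) (br x y) (?A (n - 1) u))"
      unfolding emb_minus[OF \<theta>\<iota>(1) \<iota>\<theta>(1)] \<theta>\<iota>(2) \<iota>\<theta>(2) \<iota>(2)[OF u]
        \<iota>(2)[OF twist_emb(1)[OF u]] theta_emb(2)[OF u] twist_emb(2)[OF u] lie_ins
      by simp
  qed
  have dd: "?\<theta> (n - 1) (\<alpha>L y) (?d n u) = ?d n (?\<theta> n y u)" if u: "u \<in> carrier (C n)" for n u
  proof (rule emb_inj)
    note d = diff_emb[OF u refl]
    show "?\<theta> (n - 1) (\<alpha>L y) (?d n u) \<in> carrier (C (n - 1))" by (rule theta_emb(1)[OF d(1)])
    show "?d n (?\<theta> n y u) \<in> carrier (C (n - 1))" by (rule diff_emb(1)[OF theta_emb(1)[OF u] refl])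
    show "emb (?\<theta> (n - 1) (\<alpha>L y) (?d n u)) = emb (?d n (?\<theta> n y u))"
      unfolding theta_emb(2)[OF d(1)] d(2) diff_emb(2)[OF theta_emb(1)[OF u] refl]
        theta_emb(2)[OF u] by (rule lie_bd)
  qed
  have e: "?d n (?d (n + 1) u) = \<zero>\<^bsub>C (n - 1)\<^esub>" if u: "u \<in> carrier (C (n + 1))" for n u
  proof (rule emb_inj)
    have du: "?d (n + 1) u \<in> carrier (C n)" by (rule diff_emb(1)[OF u]) simp
    show "?d n (?d (n + 1) u) \<in> carrier (C (n - 1))" by (rule diff_emb(1)[OF du refl])
    show "\<zero>\<^bsub>C (n - 1)\<^esub> \<in> carrier (C (n - 1))" by (rule chain_group_closed(4))
    show "emb (?d n (?d (n + 1) u)) = emb \<zero>\<^bsub>C (n - 1)\<^esub>"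
      unfolding diff_emb(2)[OF du refl] diff_emb(2)[OF u refl] bd_bd emb_zero ..
  qed
  show ?thesis
    unfolding Let_def using a b c dd e by blast
qed

end
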